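(* For every $t\in[0,1]$, let $F(\mathcal{T})^a_t$ be the function on the tangent bundle $T(\mathcal{E}(S,\mathcal{T})_1)$ of $\mathcal{E}(S,\mathcal{T})_1$ given by $$((A_{ijk}),(v_{ijk}))\mapsto(1-t)\max_{(i,j,k)\in\mathcal{J}}\left\{\frac{v_{ijk}}{A_{ijk}}\right\}+t\max_{(i,j,k)\in\mathcal{J}}\left\{\frac{-v_{ijk}}{A_{ijk}}\right\}.$$ Then the metric $\eta^a_t$ is induced by the Finsler structure on $\mathcal{E}(S,\mathcal{T})_1$ given by $F(\mathcal{T})^a_t$; that is, $F(\mathcal{T})^a_t$ is a Finsler structure and for all $A,B\in\mathcal{E}(S,\mathcal{T})_1$, $\eta^a_t(A,B)=\inf_c\int_0^1F(\mathcal{T})^a_t(\dot c(s))\,ds$, where $c$ ranges over all piecewise $C^1$ curves $c:[0,1]\to\mathcal{E}(S,\mathcal{T})_1$ with $c(0)=A$ and $c(1)=B$. Furthermore, for any two points of the metric space $(\mathcal{E}(S,\mathcal{T})_1,\eta^a_t)$, there is always a bigeodesic between them.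
   Context: $\mathbb{R}_+^*$ denotes the set of positive reals. Let $S$ be a compact surface, possibly with boundary, and $\mathcal{T}$ a finite triangulation of $S$ with set of edges $E(\mathcal{T})=\{e_i\}$. Fix a set $\mathcal{J}$ of ordered triples $(i,j,k)$ of edge indices such that: (1) for each $(i,j,k)\in\mathcal{J}$, $e_i,e_j,e_k$ are the edges of a face of $\mathcal{T}$; (2) if a face has edges $e_i,e_j,e_k$, some permutation of $(i,j,k)$ is in $\mathcal{J}$; (3) if $(i,j,k)\in\mathcal{J}$, no odd permutation of it is in $\mathcal{J}$; (4) if $(i,j,k)\in\mathcal{J}$, all even permutations of it are in $\mathcal{J}$. $\mathcal{E}(S,\mathcal{T})$ is the set of singular Euclidean metrics $\mu$ on $S$ adapted to $\mathcal{T}$ (each face is a Euclidean triangle; the metric is locally Euclidean except perhaps at the vertices); such $\mu$ is determined by its edge lengths $l_\mu(e_i)>0$, which are arbitrary subject to the strict triangle inequalities for each face. It is identified with its image in $(\mathbb{R}_+^* )^{\mathcal{J}}$ under the injective map $\mu\mapsto(A_{ijk})$, $A_{ijk}=\frac{l_\mu(e_j)+l_\mu(e_k)-l_\mu(e_i)}{2}$. This image is the set of $(A_{ijk})\in(\mathbb{R}_+^* )^{\mathcal{J}}$ with $A_{jki}+A_{kij}=A_{j'k'i}+A_{k'ij'}$ whenever $(i,j,k),(i,j',k')\in\mathcal{J}$ with $j\ne j'$, $k\neq k'$ (both sides equal the length of the interior edge $e_i$). $\mathrm{Ar}(A)$ is the area of the singular flat metric corresponding to $A$, i.e. the sum over the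 faces of $\mathcal{T}$ (with edges $e_i,e_j,e_k$, $(i,j,k)\in\mathcal{J}$) of $\sqrt{(A_{ijk}+A_{jki}+A_{kij})A_{ijk}A_{jki}A_{kij}}$. Set $\mathcal{E}(S,\mathcal{T})_1=\{A\in\mathcal{E}(S,\mathcal{T}):\mathrm{Ar}(A)=1\}$, an embedded differentiable submanifold of $(\mathbb{R}_+^* )^{\mathcal{J}}$, whose tangent vectors are regarded as vectors in $\mathbb{R}^{\mathcal{J}}$. The (not necessarily symmetric) metric $\eta$ on it is $\eta(A,B)=\log\max_{(i,j,k)\in\mathcal{J}}\frac{B_{ijk}}{A_{ijk}}$, and $\eta^a_t(A,B)=(1-t)\eta(A,B)+t\,\eta(B,A)$. A Minkowski norm on a real vector space $V$ is a function $\|\cdot\|:V\to[0,\infty)$ such that for all $v,w\in V$: $\|v\|=0$ iff $v=0$; $\|sv\|=s\|v\|$ for $s>0$; and $\|sv+(1-s)w\|\le s\|v\|+(1-s)\|w\|$ for $s\in[0,1]$. A Finsler structure on a differentiable manifold $M$ is a continuous function $F:TM\to[0,\infty)$ whose restriction to each tangent space is a Minkowski norm. A possibly non-symmetric metric space $(X,d)$ carries the topology induced by $\max\{d(x,y),d(y,x)\}$. A continuous path $\alpha:[a,b]\to X$ is a geodesic if $d(\alpha(u),\alpha(w))=d(\alpha(u),\alpha(v))+d(\alpha(v),\alpha(w))$ for all $u\le v\le w$ in $[a,b]$. It is a bigeodesic if both $\alpha$ and the same path traversed in the reverse direction are geodesics. It is between $x$ and $y$ if $\alpha(a)=x$, $\alpha(b)=y$.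 *)

theory Defs
  imports "HOL-Analysis.Analysis"
begin

section \<open>Compact surfaces and triangulations\<close>

(* Second countability and finiteness of the number of components follow from compactness.
   Surfaces are not required to be connected or orientable. *)
definition compact_surface :: "'s topology \<Rightarrow> bool" where
  "compact_surface S \<longleftrightarrow>
     compact_space S \<and> Hausdorff_space S \<and>
     (\<forall>x\<in>topspace S. \<exists>U W. openin S U \<and> x \<in> U \<and>
        openin (top_of_set {z::real^2. 0 \<le> z $ 2}) W \<and>
        subtopology S U homeomorphic_space top_of_set W)"

(* The standard 2-simplex in barycentric coordinates; its vertices are axis n 1, and its
   n-th side is the one opposite to axis n 1. *)
definition std_triangle :: "(real^3) set" where
  "std_triangle = {x. (\<forall>n. 0 \<le> x $ n) \<and> (\<Sum>n\<in>UNIV. x $ n) = 1}"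

definition std_interior :: "(real^3) set" where
  "std_interior = {x \<in> std_triangle. \<forall>n. 0 < x $ n}"

definition std_side :: "3 \<Rightarrow> (real^3) set" where
  "std_side n = {x \<in> std_triangle. x $ n = 0}"

definition std_open_side :: "3 \<Rightarrow> (real^3) set" where
  "std_open_side n = {x \<in> std_triangle. x $ n = 0 \<and> (\<forall>m. m \<noteq> n \<longrightarrow> 0 < x $ m)}"

(* Vertices, edges and faces are subsets of the surface; the edges are indexed by 'e, so
   "edge T i" is e_i. *)
record ('s, 'e) triangulation =
  verts :: "'s set"
  edge :: "'e \<Rightarrow> 's set"
  faces :: "'s set set"

definition skeleton :: "('s, 'e, 'z) triangulation_scheme \<Rightarrow> 's set" where
  "skeleton T = verts T \<union> (\<Union>i. edge T i)"

(* A parametrisation of the face f by the standard triangle which sends the n-th side onto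
   the edge of index \<sigma> n, and which is injective away from the vertices and sides, and along each
   side. Distinct vertices or sides of the triangle may be identified in the surface. *)
definition characteristic_map ::
  "'s topology \<Rightarrow> ('s, 'e, 'z) triangulation_scheme \<Rightarrow> 's set \<Rightarrow> (3 \<Rightarrow> 'e) \<Rightarrow> (real^3 \<Rightarrow> 's) \<Rightarrow> bool"
where
  "characteristic_map S T f \<sigma> \<phi> \<longleftrightarrow>
     continuous_map (top_of_set std_triangle) S \<phi> \<and> \<phi> ` std_triangle = f \<and>
     inj_on \<phi> std_interior \<and> \<phi> ` std_interior \<inter> skeleton T = {} \<and>
     (\<forall>n. \<phi> ` std_side n = edge T (\<sigma> n) \<and> inj_on \<phi> (std_open_side n) \<and>
          \<phi> ` std_open_side n \<inter> verts T = {} \<and> \<phi> (axis n 1) \<in> verts T)"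

(* e_i, e_j, e_k are the edges of the face f, in some order and with multiplicity. *)
definition face_edges ::
  "'s topology \<Rightarrow> ('s, 'e, 'z) triangulation_scheme \<Rightarrow> 's set \<Rightarrow> 'e \<Rightarrow> 'e \<Rightarrow> 'e \<Rightarrow> bool" where
  "face_edges S T f i j k \<longleftrightarrow>
     (\<exists>\<sigma> \<phi>. characteristic_map S T f \<sigma> \<phi> \<and> \<sigma> 1 = i \<and> \<sigma> 2 = j \<and> \<sigma> 3 = k)"

(* Finite triangulations in the wide sense used for flat surfaces: besides simplicial complexes,
   triangulations with identified vertices (such as one-vertex triangulations) are allowed. *)
definition is_triangulation :: "'s topology \<Rightarrow> ('s, 'e::finite) triangulation \<Rightarrow> bool" where
  "is_triangulation S T \<longleftrightarrow>
     finite (verts T) \<and> verts T \<subseteq> topspace S \<and> finite (faces T) \<and>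
     \<Union>(faces T) = topspace S \<and>
     (\<forall>f\<in>faces T. \<exists>i j k. face_edges S T f i j k) \<and>
     (\<forall>i. \<exists>f\<in>faces T. \<exists>j k. face_edges S T f i j k) \<and>
     (\<forall>i j. i \<noteq> j \<longrightarrow> edge T i \<inter> edge T j \<subseteq> verts T) \<and>
     (\<forall>f\<in>faces T. \<forall>g\<in>faces T. f \<noteq> g \<longrightarrow> f \<inter> g \<subseteq> skeleton T)"

definition face_triples ::
  "'s topology \<Rightarrow> ('s, 'e::finite) triangulation \<Rightarrow> ('e \<times> 'e \<times> 'e) set \<Rightarrow> bool" where
  "face_triples S T J \<longleftrightarrow>
     (\<forall>i j k. (i, j, k) \<in> J \<longrightarrow> (\<exists>f\<in>faces T. face_edges S T f i j k)) \<and>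
     (\<forall>f\<in>faces T. \<forall>i j k. face_edges S T f i j k \<longrightarrow>
        {(i,j,k), (j,k,i), (k,i,j), (j,i,k), (i,k,j), (k,j,i)} \<inter> J \<noteq> {}) \<and>
     (\<forall>i j k. (i, j, k) \<in> J \<longrightarrow> (j, i, k) \<notin> J \<and> (i, k, j) \<notin> J \<and> (k, j, i) \<notin> J) \<and>
     (\<forall>i j k. (i, j, k) \<in> J \<longrightarrow> (j, k, i) \<in> J \<and> (k, i, j) \<in> J)"


section \<open>Singular Euclidean metrics\<close>

(* The space R^J is the subspace of real^('e \<times> 'e \<times> 'e) of vectors vanishing outside J. *)
definition coord_space :: "('e::finite \<times> 'e \<times> 'e) set \<Rightarrow> (real^('e \<times> 'e \<times> 'e)) set" where
  "coord_space J = {v. \<forall>p. p \<notin> J \<longrightarrow> v $ p = 0}"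

(* A singular Euclidean metric adapted to T is represented by its edge lengths. *)
definition edge_lengths :: "'s topology \<Rightarrow> ('s, 'e::finite) triangulation \<Rightarrow> ('e \<Rightarrow> real) set" where
  "edge_lengths S T =
     {l. (\<forall>i. 0 < l i) \<and>
         (\<forall>f\<in>faces T. \<forall>i j k. face_edges S T f i j k \<longrightarrow> l i < l j + l k)}"

definition A_coords ::
  "('e::finite \<times> 'e \<times> 'e) set \<Rightarrow> ('e \<Rightarrow> real) \<Rightarrow> real^('e \<times> 'e \<times> 'e)" where
  "A_coords J l = (\<chi> p. if p \<in> J then (case p of (i, j, k) \<Rightarrow> (l j + l k - l i) / 2) else 0)"

definition euclidean_metrics ::
  "'s topology \<Rightarrow> ('s, 'e::finite) triangulation \<Rightarrow> ('e \<times> 'e \<times> 'e) set \<Rightarrow> (real^('e \<times> 'e \<times> 'e)) set"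
where
  "euclidean_metrics S T J = A_coords J ` edge_lengths S T"

(* Heron's formula. The choice of the triple does not matter, see face_area_eq. *)
definition face_area ::
  "'s topology \<Rightarrow> ('s, 'e::finite) triangulation \<Rightarrow> ('e \<times> 'e \<times> 'e) set \<Rightarrow>
     real^('e \<times> 'e \<times> 'e) \<Rightarrow> 's set \<Rightarrow> real" where
  "face_area S T J A f =
     (case (SOME (i, j, k). (i, j, k) \<in> J \<and> face_edges S T f i j k) of (i, j, k) \<Rightarrow>
        sqrt ((A $ (i,j,k) + A $ (j,k,i) + A $ (k,i,j)) * A $ (i,j,k) * A $ (j,k,i) * A $ (k,i,j)))"

definition area ::
  "'s topology \<Rightarrow> ('s, 'e::finite) triangulation \<Rightarrow> ('e \<times> 'e \<times> 'e) set \<Rightarrow>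
     real^('e \<times> 'e \<times> 'e) \<Rightarrow> real" where
  "area S T J A = (\<Sum>f\<in>faces T. face_area S T J A f)"

definition euclidean_metrics1 ::
  "'s topology \<Rightarrow> ('s, 'e::finite) triangulation \<Rightarrow> ('e \<times> 'e \<times> 'e) set \<Rightarrow> (real^('e \<times> 'e \<times> 'e)) set"
where
  "euclidean_metrics1 S T J = {A \<in> euclidean_metrics S T J. area S T J A = 1}"

definition eta ::
  "('e::finite \<times> 'e \<times> 'e) set \<Rightarrow> real^('e \<times> 'e \<times> 'e) \<Rightarrow> real^('e \<times> 'e \<times> 'e) \<Rightarrow> real" where
  "eta J A B = ln (MAX p\<in>J. B $ p / A $ p)"

definition eta_a ::
  "('e::finite \<times> 'e \<times> 'e) set \<Rightarrow> real \<Rightarrow> real^('e \<times> 'e \<times> 'e) \<Rightarrow> real^('e \<times> 'e \<times> 'e) \<Rightarrow> real" where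
  "eta_a J t A B = (1 - t) * eta J A B + t * eta J B A"

definition F_a ::
  "('e::finite \<times> 'e \<times> 'e) set \<Rightarrow> real \<Rightarrow> real^('e \<times> 'e \<times> 'e) \<Rightarrow> real^('e \<times> 'e \<times> 'e) \<Rightarrow> real" where
  "F_a J t A v = (1 - t) * (MAX p\<in>J. v $ p / A $ p) + t * (MAX p\<in>J. - v $ p / A $ p)"


section \<open>Finsler structures on embedded submanifolds\<close>

(* For an embedded differentiable submanifold M: the velocities at A of C^1 curves in M. *)
definition tangent_space :: "'a::real_normed_vector set \<Rightarrow> 'a \<Rightarrow> 'a set" where
  "tangent_space M A =
     {v. \<exists>\<epsilon>>0. \<exists>\<gamma>::real \<Rightarrow> 'a. \<gamma> C1_differentiable_on {-\<epsilon><..<\<epsilon>} \<and> \<gamma> ` {-\<epsilon><..<\<epsilon>} \<subseteq> M \<and>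
            \<gamma> 0 = A \<and> (\<gamma> has_vector_derivative v) (at 0)}"

definition minkowski_norm :: "'a::real_vector set \<Rightarrow> ('a \<Rightarrow> real) \<Rightarrow> bool" where
  "minkowski_norm V N \<longleftrightarrow>
     subspace V \<and>
     (\<forall>v\<in>V. 0 \<le> N v) \<and>
     (\<forall>v\<in>V. N v = 0 \<longleftrightarrow> v = 0) \<and>
     (\<forall>v\<in>V. \<forall>s>0. N (s *\<^sub>R v) = s * N v) \<and>
     (\<forall>v\<in>V. \<forall>w\<in>V. \<forall>s\<in>{0..1}. N (s *\<^sub>R v + (1 - s) *\<^sub>R w) \<le> s * N v + (1 - s) * N w)"

definition finsler_structure ::
  "'a::real_normed_vector set \<Rightarrow> ('a \<Rightarrow> 'a \<Rightarrow> real) \<Rightarrow> bool" where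
  "finsler_structure M F \<longleftrightarrow>
     continuous_on (SIGMA A:M. tangent_space M A) (\<lambda>(A, v). F A v) \<and>
     (\<forall>A\<in>M. minkowski_norm (tangent_space M A) (F A))"

(* C^1 up to the end points (with one-sided derivatives) on each of the closed subintervals
   [s 0, s 1], ..., [s (n-1), s n]. The library's piecewise_C1_differentiable_on is weaker:
   it does not control the derivative near the break points, so that curves of infinite length
   would be included. *)
definition piecewise_C1 :: "(real \<Rightarrow> 'a::real_normed_vector) \<Rightarrow> real \<Rightarrow> real \<Rightarrow> bool" where
  "piecewise_C1 c a b \<longleftrightarrow>
     (\<exists>(n::nat) s. s 0 = a \<and> s n = b \<and> (\<forall>m<n. s m < s (Suc m)) \<and>
        (\<forall>m<n. \<exists>c'. continuous_on {s m..s (Suc m)} c' \<and>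
           (\<forall>u\<in>{s m..s (Suc m)}.
              (c has_vector_derivative c' u) (at u within {s m..s (Suc m)}))))"

definition finsler_length :: "('a::real_normed_vector \<Rightarrow> 'a \<Rightarrow> real) \<Rightarrow> (real \<Rightarrow> 'a) \<Rightarrow> real" where
  "finsler_length F c = integral {0..1} (\<lambda>s. F (c s) (vector_derivative c (at s within {0..1})))"

definition curves_between :: "'a::real_normed_vector set \<Rightarrow> 'a \<Rightarrow> 'a \<Rightarrow> (real \<Rightarrow> 'a) set" where
  "curves_between M A B = {c. piecewise_C1 c 0 1 \<and> c ` {0..1} \<subseteq> M \<and> c 0 = A \<and> c 1 = B}"

definition induced_by_finsler ::
  "'a::real_normed_vector set \<Rightarrow> ('a \<Rightarrow> 'a \<Rightarrow> real) \<Rightarrow> ('a \<Rightarrow> 'a \<Rightarrow> real) \<Rightarrow> bool" where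
  "induced_by_finsler M F d \<longleftrightarrow>
     finsler_structure M F \<and>
     (\<forall>A\<in>M. \<forall>B\<in>M. d A B = (INF c\<in>curves_between M A B. finsler_length F c))"


section \<open>Geodesics in non-symmetric metric spaces\<close>

(* Continuity with respect to the metric max {d x y, d y x}. *)
definition continuous_path ::
  "'a set \<Rightarrow> ('a \<Rightarrow> 'a \<Rightarrow> real) \<Rightarrow> real \<Rightarrow> real \<Rightarrow> (real \<Rightarrow> 'a) \<Rightarrow> bool" where
  "continuous_path X d a b \<alpha> \<longleftrightarrow>
     \<alpha> ` {a..b} \<subseteq> X \<and>
     (\<forall>u\<in>{a..b}. \<forall>\<epsilon>>0. \<exists>\<delta>>0. \<forall>v\<in>{a..b}. \<bar>v - u\<bar> < \<delta> \<longrightarrow>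
        max (d (\<alpha> u) (\<alpha> v)) (d (\<alpha> v) (\<alpha> u)) < \<epsilon>)"

definition geodesic ::
  "'a set \<Rightarrow> ('a \<Rightarrow> 'a \<Rightarrow> real) \<Rightarrow> real \<Rightarrow> real \<Rightarrow> (real \<Rightarrow> 'a) \<Rightarrow> bool" where
  "geodesic X d a b \<alpha> \<longleftrightarrow>
     continuous_path X d a b \<alpha> \<and>
     (\<forall>u v w. a \<le> u \<and> u \<le> v \<and> v \<le> w \<and> w \<le> b \<longrightarrow>
        d (\<alpha> u) (\<alpha> w) = d (\<alpha> u) (\<alpha> v) + d (\<alpha> v) (\<alpha> w))"

definition bigeodesic ::
  "'a set \<Rightarrow> ('a \<Rightarrow> 'a \<Rightarrow> real) \<Rightarrow> real \<Rightarrow> real \<Rightarrow> (real \<Rightarrow> 'a) \<Rightarrow> bool" where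
  "bigeodesic X d a b \<alpha> \<longleftrightarrow>
     geodesic X d a b \<alpha> \<and> geodesic X d a b (\<lambda>u. \<alpha> (a + b - u))"


section \<open>Consistency of the definitions\<close>

lemma ex_std_open_side: "std_open_side n \<noteq> {}"
proof -
  have "(\<Sum>m\<in>UNIV. if m = n then 0 else 1/2::real) = 1"
    using exhaust_3[of n] unfolding sum_3 by (elim disjE) simp_all
  then have "(\<chi> m. if m = n then 0 else 1/2) \<in> std_open_side n"
    by (simp add: std_open_side_def std_triangle_def)
  then show ?thesis by blast
qed

lemma std_side_open: "x \<in> std_open_side n \<Longrightarrow> x \<in> std_side n"
  by (auto simp: std_open_side_def std_side_def)

lemma boundary_std_triangle:
  assumes "x \<in> std_triangle" "x \<notin> std_interior" shows "\<exists>n. x \<in> std_side n"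
proof -
  obtain n where "\<not> 0 < x $ n" "0 \<le> x $ n"
    using assms unfolding std_interior_def std_triangle_def by blast
  then have "x $ n = 0" by linarith
  then show ?thesis using assms by (auto simp: std_side_def)
qed

lemma face_edges_subset:
  assumes T: "is_triangulation S T"
    and 1: "face_edges S T f i j k" and 2: "face_edges S T f i' j' k'"
  shows "{i', j', k'} \<subseteq> {i, j, k}"
proof
  fix m assume m: "m \<in> {i', j', k'}"
  have charD: "y \<in> std_side r \<Longrightarrow> g y \<in> edge T (\<sigma>' r)"
    "y \<in> std_open_side r \<Longrightarrow> g y \<notin> verts T"
    "y \<in> std_interior \<Longrightarrow> g y \<notin> skeleton T"
    "y \<in> std_triangle \<Longrightarrow> g y \<in> f"
    if "characteristic_map S T f \<sigma>' g" for \<sigma>' g y r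
    using that unfolding characteristic_map_def by blast+
  from 2 obtain \<sigma> \<psi> where \<psi>: "characteristic_map S T f \<sigma> \<psi>" "\<sigma> 1 = i'" "\<sigma> 2 = j'" "\<sigma> 3 = k'"
    by (auto simp: face_edges_def)
  with m obtain n where n: "\<sigma> n = m" by auto
  from 1 obtain \<tau> \<phi> where \<phi>: "characteristic_map S T f \<tau> \<phi>" "\<tau> 1 = i" "\<tau> 2 = j" "\<tau> 3 = k"
    by (auto simp: face_edges_def)
  obtain x where x: "x \<in> std_open_side n" using ex_std_open_side by blast
  have xe: "\<psi> x \<in> edge T m" and xv: "\<psi> x \<notin> verts T" and xf: "\<psi> x \<in> f"
    using charD[OF \<psi>(1)] n x std_side_open[OF x] by (blast, blast, auto simp: std_open_side_def)
  from xf \<phi>(1) obtain y where y: "y \<in> std_triangle" "\<psi> x = \<phi> y"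
    by (auto simp: characteristic_map_def)
  have "\<psi> x \<in> skeleton T" using xe by (auto simp: skeleton_def)
  then have "y \<notin> std_interior" using charD(3)[OF \<phi>(1)] y(2) by auto
  with y(1) obtain r where "y \<in> std_side r" using boundary_std_triangle by blast
  then have "\<psi> x \<in> edge T (\<tau> r)" using charD(1)[OF \<phi>(1)] y(2) by auto
  then have "m = \<tau> r" using T xe xv unfolding is_triangulation_def by blast
  then show "m \<in> {i, j, k}" using exhaust_3[of r] \<phi>(2-4) by auto
qed

lemma face_area_eq:
  assumes T: "is_triangulation S T" and J: "face_triples S T J"
    and p: "(i, j, k) \<in> J" "face_edges S T f i j k"
  shows "face_area S T J A f =
     sqrt ((A $ (i,j,k) + A $ (j,k,i) + A $ (k,i,j)) * A $ (i,j,k) * A $ (j,k,i) * A $ (k,i,j))"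
proof -
  define q where "q = (SOME (i, j, k). (i, j, k) \<in> J \<and> face_edges S T f i j k)"
  obtain a b c where q: "q = (a, b, c)" by (cases q)
  have "case q of (i, j, k) \<Rightarrow> (i, j, k) \<in> J \<and> face_edges S T f i j k"
    unfolding q_def by (rule someI[of _ "(i, j, k)"]) (use p in simp)
  then have abc: "(a, b, c) \<in> J" "face_edges S T f a b c" by (auto simp: q)
  have odd: "(y, x, z) \<notin> J" "(x, z, y) \<notin> J" "(z, y, x) \<notin> J" if "(x, y, z) \<in> J" for x y z
    using J that unfolding face_triples_def by blast+
  have dist: "x \<noteq> y \<and> y \<noteq> z \<and> x \<noteq> z" if "(x, y, z) \<in> J" for x y z
    using odd[OF that] that by auto
  have "{a, b, c} = {i, j, k}"
    using face_edges_subset[OF T p(2) abc(2)] face_edges_subset[OF T abc(2) p(2)] by blast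
  then have "a \<in> {i, j, k}" "b \<in> {i, j, k}" "c \<in> {i, j, k}" by blast+
  then have "(a, b, c) \<in> {(i,j,k), (j,k,i), (k,i,j), (j,i,k), (i,k,j), (k,j,i)}"
    using dist[OF abc(1)] by (elim insertE emptyE) simp_all
  moreover have "(j,i,k) \<notin> J" "(i,k,j) \<notin> J" "(k,j,i) \<notin> J"
    using odd[OF p(1)] by blast+
  ultimately have "(a, b, c) \<in> {(i,j,k), (j,k,i), (k,i,j)}" using abc(1) by auto
  then show ?thesis
    unfolding face_area_def q_def[symmetric] q by (auto simp: algebra_simps)
qed

(* Description of the image by equations, for triangulations in which two faces have at most
   one common edge. *)
lemma euclidean_metrics_eq:
  assumes T: "is_triangulation S T" and J: "face_triples S T J"
    and one: "\<And>i j k j' k'. (i,j,k) \<in> J \<Longrightarrow> (i,j',k') \<in> J \<Longrightarrow> j = j' \<longleftrightarrow> k = k'"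
  shows "euclidean_metrics S T J =
    {A \<in> coord_space J. (\<forall>p\<in>J. 0 < A $ p) \<and>
       (\<forall>i j k j' k'. (i,j,k) \<in> J \<and> (i,j',k') \<in> J \<and> j \<noteq> j' \<and> k \<noteq> k' \<longrightarrow>
          A $ (j,k,i) + A $ (k,i,j) = A $ (j',k',i) + A $ (k',i,j'))}" (is "_ = ?R")
proof
  have cyc: "(j,k,i) \<in> J" "(k,i,j) \<in> J" if "(i,j,k) \<in> J" for i j k
    using J that unfolding face_triples_def by blast+
  have sub: "\<exists>f\<in>faces T. face_edges S T f i j k" if "(i,j,k) \<in> J" for i j k
    using J that unfolding face_triples_def by blast
  have perm: "{(i,j,k), (j,k,i), (k,i,j), (j,i,k), (i,k,j), (k,j,i)} \<inter> J \<noteq> {}"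
    if "f \<in> faces T" "face_edges S T f i j k" for f i j k
    using J[unfolded face_triples_def, THEN conjunct2, THEN conjunct1] that by simp
  have lt: "l i < l j + l k" if "l \<in> edge_lengths S T" "(i,j,k) \<in> J" for l i j k
    using sub[OF that(2)] that(1) unfolding edge_lengths_def by blast
  show "euclidean_metrics S T J \<subseteq> ?R"
    using cyc lt
    by (auto simp: euclidean_metrics_def A_coords_def coord_space_def field_simps)
  show "?R \<subseteq> euclidean_metrics S T J"
  proof
    fix A assume A: "A \<in> ?R"
    have all: "A $ (j,k,i) + A $ (k,i,j) = A $ (j',k',i) + A $ (k',i,j')"
      if "(i,j,k) \<in> J" "(i,j',k') \<in> J" for i j k j' k'
    proof (cases "j = j'")
      case True
      then show ?thesis using one[OF that] by simp
    next
      case False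
      then show ?thesis using A that one[OF that] by blast
    qed
    have ex: "\<exists>j k. (i,j,k) \<in> J" for i
    proof -
      obtain f j k where "f \<in> faces T" "face_edges S T f i j k"
        using T[unfolded is_triangulation_def] by metis
      then have "{(i,j,k), (j,k,i), (k,i,j), (j,i,k), (i,k,j), (k,j,i)} \<inter> J \<noteq> {}"
        using perm by simp
      then consider "(i,j,k) \<in> J" | "(j,k,i) \<in> J" | "(k,i,j) \<in> J"
        | "(j,i,k) \<in> J" | "(i,k,j) \<in> J" | "(k,j,i) \<in> J" by blast
      then show ?thesis by cases (use cyc in \<open>meson\<close>)+
    qed
    then obtain a b where ab: "\<And>i. (i, a i, b i) \<in> J" by metis
    define l where "l i = A $ (a i, b i, i) + A $ (b i, i, a i)" for i
    have l: "l i = A $ (j,k,i) + A $ (k,i,j)" if "(i,j,k) \<in> J" for i j k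
      unfolding l_def using all[OF ab that] .
    have pos: "0 < A $ p" if "p \<in> J" for p using A that by auto
    have tri: "l i < l j + l k \<and> l j < l k + l i \<and> l k < l i + l j" if "(i,j,k) \<in> J" for i j k
      using l[OF that] l[OF cyc(1)[OF that]] l[OF cyc(2)[OF that]] pos[OF that]
        pos[OF cyc(1)[OF that]] pos[OF cyc(2)[OF that]] by linarith
    have "l \<in> edge_lengths S T"
      unfolding edge_lengths_def
    proof safe
      show "0 < l i" for i
        using cyc[OF ab[of i]] pos unfolding l_def by (simp add: add_pos_pos)
      fix f i j k assume "f \<in> faces T" "face_edges S T f i j k"
      then have "{(i,j,k), (j,k,i), (k,i,j), (j,i,k), (i,k,j), (k,j,i)} \<inter> J \<noteq> {}"
        using perm by simp
      then consider "(i,j,k) \<in> J" | "(j,k,i) \<in> J" | "(k,i,j) \<in> J"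
        | "(j,i,k) \<in> J" | "(i,k,j) \<in> J" | "(k,j,i) \<in> J" by blast
      then show "l i < l j + l k"
        by cases (use tri in \<open>metis add.commute\<close>)+
    qed
    moreover have "A_coords J l = A"
    proof -
      have "(l j + l k - l i) / 2 = A $ (i,j,k)" if "(i,j,k) \<in> J" for i j k
        using l[OF that] l[OF cyc(1)[OF that]] l[OF cyc(2)[OF that]] by simp
      then show ?thesis
        using A by (auto simp: A_coords_def vec_eq_iff coord_space_def)
    qed
    ultimately show "A \<in> euclidean_metrics S T J"
      unfolding euclidean_metrics_def by blast
  qed
qed

end

theory Submission
  imports Defs
begin

text \<open>The metrics of area one form the slice of an open convex cone by a level set of the area, and
  the area is homogeneous and strictly increasing in every coordinate. Rescaling the straight segment
  from \<open>A\<close> to \<open>B\<close> to area one gives a curve along which every coordinate ratio is, up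
  to a factor common to all coordinates, monotone in \<open>B\<^sub>p / A\<^sub>p\<close>. Hence one and the same index
  \<open>p\<close> maximises, and one and the same index \<open>q\<close> minimises, all the ratios in \<open>\<eta>\<close> and in
  the Finsler norm along the curve; so it is a geodesic in both directions, and its length is the
  distance. Conversely, integrating the logarithmic derivatives of the coordinates \<open>p\<close> and
  \<open>q\<close> along any curve bounds its length from below. Strict monotonicity of the area forces a
  nonzero tangent vector to have coordinates of both signs, which makes the norm definite.\<close>


section \<open>Maxima over finite sets and the integrand of the length\<close>

lemma MAX_eqI:
  fixes f :: "'a::finite \<Rightarrow> real"
  assumes "p \<in> J" "\<And>x. x \<in> J \<Longrightarrow> f x \<le> f p"
  shows "(MAX x\<in>J. f x) = f p"
  using assms by (intro Max_eqI) auto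

lemma MAX_attained:
  fixes f :: "'a::finite \<Rightarrow> real"
  assumes "J \<noteq> {}"
  obtains p where "p \<in> J" "\<And>x. x \<in> J \<Longrightarrow> f x \<le> f p"
  using obtains_MAX[of J f] assms by (metis Max_ge finite finite_imageI image_eqI)

lemma continuous_on_MAX:
  fixes f :: "'a \<Rightarrow> 'b::topological_space \<Rightarrow> real"
  assumes "finite J" "J \<noteq> {}" "\<And>p. p \<in> J \<Longrightarrow> continuous_on X (f p)"
  shows "continuous_on X (\<lambda>x. MAX p\<in>J. f p x)"
  using assms
proof (induction J rule: finite_ne_induct)
  case (insert p J)
  then have "continuous_on X (\<lambda>x. max (f p x) (MAX p\<in>J. f p x))"
    by (intro continuous_on_max) auto
  with insert.hyps show ?case by simp
qed simp

lemma divide_le_divide_iff: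
  "0 < b \<Longrightarrow> 0 < d \<Longrightarrow> a / b \<le> c / d \<longleftrightarrow> a * d \<le> c * b" for a b c d :: real
  by (simp add: pos_divide_le_eq pos_le_divide_eq)

lemma eta_a_swap: "eta_a J t B A = eta_a J (1 - t) A B"
  by (simp add: eta_a_def)

text \<open>\<open>finsler_length\<close> differentiates within \<open>{0..1}\<close>, whereas a
  piece of a curve carries a derivative within \<open>{a..b}\<close>. The two agree in the interior
  of the piece, and its end points, where the curve may have a corner, form a null set.\<close>

lemma finsler_integrand_has_integral:
  fixes F :: "'a::real_normed_vector \<Rightarrow> 'a \<Rightarrow> real"
  assumes c': "\<And>u. u \<in> {a..b} \<Longrightarrow> (c has_vector_derivative c' u) (at u within {a..b})"
    and cont: "continuous_on {a..b} (\<lambda>u. F (c u) (c' u))"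
    and sub: "{a..b} \<subseteq> {0..1}"
  shows "((\<lambda>s. F (c s) (vector_derivative c (at s within {0..1}))) has_integral
          integral {a..b} (\<lambda>u. F (c u) (c' u))) {a..b}"
proof (rule has_integral_spike_finite[where S = "{a, b}" and f = "\<lambda>u. F (c u) (c' u)"])
  show "((\<lambda>u. F (c u) (c' u)) has_integral integral {a..b} (\<lambda>u. F (c u) (c' u))) {a..b}"
    by (rule integrable_integral[OF integrable_continuous_real[OF cont]])
  fix x assume "x \<in> {a..b} - {a, b}"
  then have x: "a < x" "x < b" "0 < x" "x < 1" using sub by auto
  have "(c has_vector_derivative c' x) (at x)"
    using c'[of x] x by (simp add: at_within_Icc_at)
  then show "F (c x) (vector_derivative c (at x within {0..1})) = F (c x) (c' x)"
    using x by (simp add: at_within_Icc_at vector_derivative_at)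
qed simp

section \<open>Level sets of an increasing function of degree two on a cone\<close>

text \<open>Isolates what is used of the area. \<open>h'_pos\<close> is strict monotonicity in
  infinitesimal form, and \<open>V_coord\<close> makes a vector of \<open>V\<close> vanish as soon
  as its coordinates in \<open>J\<close> do. The conditions on \<open>h\<close> concern all vectors
  positive on \<open>J\<close>, which form an open set, so ordinary derivatives serve instead of
  derivatives along \<open>V\<close>.\<close>

locale level_set =
  fixes J :: "('e::finite \<times> 'e \<times> 'e) set"
    and V :: "(real^('e \<times> 'e \<times> 'e)) set"
    and h :: "real^('e \<times> 'e \<times> 'e) \<Rightarrow> real"
    and h' :: "real^('e \<times> 'e \<times> 'e) \<Rightarrow> real^('e \<times> 'e \<times> 'e) \<Rightarrow> real"
  assumes J_nonempty: "J \<noteq> {}"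
    and subspace_V: "subspace V"
    and V_coord: "V \<subseteq> coord_space J"
    and h_pos: "\<And>A. \<forall>p\<in>J. 0 < A $ p \<Longrightarrow> 0 < h A"
    and h_scale: "\<And>A r. \<forall>p\<in>J. 0 < A $ p \<Longrightarrow> 0 < r \<Longrightarrow> h (r *\<^sub>R A) = r\<^sup>2 * h A"
    and h_deriv: "\<And>A. \<forall>p\<in>J. 0 < A $ p \<Longrightarrow> (h has_derivative h' A) (at A)"
    and h'_cont: "\<And>v. continuous_on {A. \<forall>p\<in>J. 0 < A $ p} (\<lambda>A. h' A v)"
    and h'_pos: "\<And>A v p. \<forall>p\<in>J. 0 < A $ p \<Longrightarrow> \<forall>p\<in>J. 0 \<le> v $ p \<Longrightarrow> p \<in> J \<Longrightarrow> 0 < v $ p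
                   \<Longrightarrow> 0 < h' A v"
begin

abbreviation pos :: "(real^('e \<times> 'e \<times> 'e)) set" where
  "pos \<equiv> {A. \<forall>p\<in>J. 0 < A $ p}"

definition M :: "(real^('e \<times> 'e \<times> 'e)) set" where
  "M = {A \<in> V. A \<in> pos \<and> h A = 1}"

lemma M_pos: "A \<in> M \<Longrightarrow> p \<in> J \<Longrightarrow> 0 < A $ p"
  by (simp add: M_def)

lemma open_pos: "open pos"
proof -
  have "pos = (\<Inter>p\<in>J. {A. 0 < A $ p})" by auto
  also have "open \<dots>" by (intro open_INT) (auto intro!: open_Collect_less continuous_intros)
  finally show ?thesis .
qed

text \<open>Reads the second maximum as the first one taken at \<open>- v\<close>, so that every
  fact about one maximum serves for both.\<close>

lemma F_a_MAX:
  "F_a J t A v = (1 - t) * (MAX p\<in>J. v $ p / A $ p) + t * (MAX p\<in>J. (- v) $ p / A $ p)"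
  by (simp add: F_a_def)

lemma continuous_on_F_a:
  assumes "continuous_on X f" "continuous_on X g" "\<And>x. x \<in> X \<Longrightarrow> f x \<in> pos"
  shows "continuous_on X (\<lambda>x. F_a J t (f x) (g x))"
  unfolding F_a_def
  using assms J_nonempty
  by (intro continuous_intros continuous_on_MAX) (fastforce dest: less_imp_neq)+

lemma continuous_on_eta:
  assumes "continuous_on X f" "continuous_on X g"
    and "\<And>x. x \<in> X \<Longrightarrow> f x \<in> pos" "\<And>x. x \<in> X \<Longrightarrow> g x \<in> pos"
  shows "continuous_on X (\<lambda>x. eta J (f x) (g x))"
  unfolding eta_def
proof (intro continuous_on_ln continuous_on_MAX)
  show "\<forall>x\<in>X. (MAX p\<in>J. g x $ p / f x $ p) \<noteq> 0"
  proof
    fix x assume x: "x \<in> X"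
    obtain p where "p \<in> J" using J_nonempty by blast
    then have "0 < g x $ p / f x $ p" using assms(3,4) x by simp
    also have "\<dots> \<le> (MAX p\<in>J. g x $ p / f x $ p)" using \<open>p \<in> J\<close> by (intro Max_ge) auto
    finally show "(MAX p\<in>J. g x $ p / f x $ p) \<noteq> 0" by simp
  qed
qed (use assms J_nonempty in \<open>auto intro!: continuous_intros dest: less_imp_neq\<close>, fastforce)

section \<open>Projection to the level set and its tangent spaces\<close>

text \<open>The radial projection of the cone onto the level set; the square root compensates the
  degree two of \<open>h\<close>.\<close>

definition rescale :: "real^('e \<times> 'e \<times> 'e) \<Rightarrow> real^('e \<times> 'e \<times> 'e)" where
  "rescale A = (1 / sqrt (h A)) *\<^sub>R A"

lemma rescale_pos: "A \<in> pos \<Longrightarrow> rescale A \<in> pos"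
  using h_pos by (simp add: rescale_def)

lemma rescale_in_M:
  assumes "A \<in> V" "A \<in> pos" shows "rescale A \<in> M"
  using assms rescale_pos[OF assms(2)] h_pos[of A] h_scale[of A "1 / sqrt (h A)"]
  by (simp add: M_def subspace_scale[OF subspace_V] power_divide rescale_def)

lemma rescale_id: "A \<in> M \<Longrightarrow> rescale A = A"
  by (simp add: M_def rescale_def)

text \<open>The derivative of \<open>rescale\<close> at \<open>A\<close> in the direction
  \<open>v\<close>. Euler's relation \<open>h' A A = 2 * h A\<close> shows that the bracket is the
  projection of \<open>v\<close> along \<open>A\<close> to the kernel of
  \<open>h' A\<close>.\<close>

definition ray_velocity ::
  "real^('e \<times> 'e \<times> 'e) \<Rightarrow> real^('e \<times> 'e \<times> 'e) \<Rightarrow> real^('e \<times> 'e \<times> 'e)" where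
  "ray_velocity A v = (1 / sqrt (h A)) *\<^sub>R (v - (h' A v / (2 * h A)) *\<^sub>R A)"

lemma rescale_line_deriv:
  assumes "A + s *\<^sub>R v \<in> pos"
  shows "((\<lambda>s. rescale (A + s *\<^sub>R v)) has_vector_derivative ray_velocity (A + s *\<^sub>R v) v) (at s)"
proof -
  let ?L = "\<lambda>s. A + s *\<^sub>R v"
  have L: "(?L has_vector_derivative v) (at s)"
    by (auto intro!: derivative_eq_intros)
  have hp: "0 < h (?L s)" using assms h_pos by simp
  have "(h has_derivative h' (?L s)) (at (?L s))" using assms h_deriv by simp
  then have "((\<lambda>s. h (?L s)) has_vector_derivative h' (?L s) v) (at s)"
    using vector_derivative_diff_chain_within[OF L, of h "h' (?L s)"]
    by (simp add: o_def has_derivative_at_withinI)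
  then have H: "((\<lambda>s. h (?L s)) has_real_derivative h' (?L s) v) (at s)"
    by (simp add: has_real_derivative_iff_has_vector_derivative)
  have "((\<lambda>s. 1 / sqrt (h (?L s))) has_real_derivative
          - (h' (?L s) v / (2 * h (?L s))) * (1 / sqrt (h (?L s)))) (at s)"
    using hp by (auto intro!: derivative_eq_intros H simp: field_simps)
  from has_vector_derivative_scaleR[OF this L]
  show ?thesis
    by (simp add: rescale_def ray_velocity_def algebra_simps)
qed

lemma continuous_on_ray_velocity:
  assumes "\<And>s. s \<in> X \<Longrightarrow> A + s *\<^sub>R v \<in> pos"
  shows "continuous_on X (\<lambda>s. ray_velocity (A + s *\<^sub>R v) v)"
proof -
  have "continuous_on pos h"
    using h_deriv has_derivative_continuous
    by (intro continuous_at_imp_continuous_on) blast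
  moreover have line: "continuous_on X (\<lambda>s. A + s *\<^sub>R v)" "(\<lambda>s. A + s *\<^sub>R v) ` X \<subseteq> pos"
    using assms by (auto intro!: continuous_intros)
  ultimately have "continuous_on X (\<lambda>s. h (A + s *\<^sub>R v))"
    by (rule continuous_on_compose2)
  moreover have "continuous_on X (\<lambda>s. h' (A + s *\<^sub>R v) v)"
    by (rule continuous_on_compose2[OF h'_cont line])
  ultimately show ?thesis
    unfolding ray_velocity_def using assms h_pos
    by (intro continuous_intros) (fastforce dest: less_imp_neq)+
qed

text \<open>A velocity is a limit of difference quotients, which lie in the closed subspace
  \<open>V\<close>, and \<open>h' A\<close> kills it because \<open>h\<close> is constant along the
  curve. Conversely, the rescaled line through \<open>A\<close> in the direction \<open>v\<close>
  stays in \<open>M\<close> for small times, and the correction in \<open>ray_velocity\<close>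
  vanishes at \<open>A\<close>.\<close>

lemma tangent_space_M:
  assumes A: "A \<in> M"
  shows "tangent_space M A = {v \<in> V. h' A v = 0}"
proof (intro set_eqI iffI)
  fix v assume "v \<in> tangent_space M A"
  then obtain \<epsilon> \<gamma> where \<epsilon>: "0 < \<epsilon>" and \<gamma>M: "\<gamma> ` {-\<epsilon><..<\<epsilon>} \<subseteq> M" and \<gamma>0: "\<gamma> 0 = A"
    and \<gamma>: "(\<gamma> has_vector_derivative v) (at (0::real))"
    unfolding tangent_space_def by blast
  have near: "\<forall>\<^sub>F s in at 0. s \<in> {-\<epsilon><..<\<epsilon>}"
    using \<epsilon> by (intro eventually_at_in_open') auto
  have lim: "((\<lambda>s. (\<gamma> s - A) /\<^sub>R s) \<longlongrightarrow> v) (at 0)"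
  proof -
    have "((\<lambda>s. norm ((1 / norm s) *\<^sub>R (\<gamma> s - (A + s *\<^sub>R v)))) \<longlongrightarrow> 0) (at 0)"
      using \<gamma> \<gamma>0 by (intro tendsto_norm_zero)
        (simp add: has_vector_derivative_def has_derivative_within)
    moreover have "\<forall>\<^sub>F s in at 0. norm ((1 / norm s) *\<^sub>R (\<gamma> s - (A + s *\<^sub>R v))) =
        norm ((\<gamma> s - A) /\<^sub>R s - v)"
      unfolding eventually_at_filter
    proof (intro always_eventually allI impI)
      fix s :: real assume "s \<noteq> 0"
      then have "(\<gamma> s - A) /\<^sub>R s - v = inverse s *\<^sub>R (\<gamma> s - (A + s *\<^sub>R v))"
        by (simp add: algebra_simps)
      then show "norm ((1 / norm s) *\<^sub>R (\<gamma> s - (A + s *\<^sub>R v))) = norm ((\<gamma> s - A) /\<^sub>R s - v)"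
        by (simp add: divide_inverse)
    qed
    ultimately have "((\<lambda>s. norm ((\<gamma> s - A) /\<^sub>R s - v)) \<longlongrightarrow> 0) (at 0)"
      by (rule Lim_transform_eventually)
    then show ?thesis by (simp add: tendsto_norm_zero_iff LIM_zero_iff)
  qed
  have "v \<in> V"
  proof (rule Lim_in_closed_set[OF closed_subspace[OF subspace_V] _ _ lim])
    show "\<forall>\<^sub>F s in at 0. (\<gamma> s - A) /\<^sub>R s \<in> V"
      using near
    proof eventually_elim
      case (elim s)
      then have "\<gamma> s \<in> V" using \<gamma>M unfolding M_def by blast
      then show ?case
        using A by (simp add: M_def subspace_diff subspace_scale subspace_V)
    qed
  qed simp
  have "(h has_derivative h' (\<gamma> 0)) (at (\<gamma> 0))"
    using A h_deriv \<gamma>0 by (simp add: M_def)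
  then have 1: "((\<lambda>s. h (\<gamma> s)) has_vector_derivative h' A v) (at 0)"
    using vector_derivative_diff_chain_within[OF \<gamma>, of h "h' (\<gamma> 0)"] \<gamma>0
    by (simp add: o_def has_derivative_at_withinI)
  have "((\<lambda>s. 1::real) has_vector_derivative h' A v) (at 0)"
    by (rule has_vector_derivative_transform_within_open[OF 1, of "{-\<epsilon><..<\<epsilon>}"])
      (use \<epsilon> \<gamma>M in \<open>auto simp: M_def image_subset_iff\<close>)
  then have "h' A v = 0"
    by (metis has_vector_derivative_const vector_derivative_at)
  with \<open>v \<in> V\<close> show "v \<in> {v \<in> V. h' A v = 0}" by simp
next
  fix v assume v: "v \<in> {v \<in> V. h' A v = 0}"
  have "open ((\<lambda>s. A + s *\<^sub>R v) -` pos)"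
    by (intro open_vimage open_pos continuous_intros)
  moreover have "0 \<in> (\<lambda>s::real. A + s *\<^sub>R v) -` pos" using A by (simp add: M_def)
  ultimately obtain \<epsilon> where \<epsilon>: "0 < \<epsilon>" "ball 0 \<epsilon> \<subseteq> (\<lambda>s::real. A + s *\<^sub>R v) -` pos"
    by (meson open_contains_ball)
  then have pos: "A + s *\<^sub>R v \<in> pos" if "s \<in> {-\<epsilon><..<\<epsilon>}" for s
    using that by (auto simp: subset_iff dist_real_def)
  let ?\<gamma> = "\<lambda>s. rescale (A + s *\<^sub>R v)"
  have "?\<gamma> C1_differentiable_on {-\<epsilon><..<\<epsilon>}"
    unfolding C1_differentiable_on_def
    by (intro exI[of _ "\<lambda>s. ray_velocity (A + s *\<^sub>R v) v"] conjI ballI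
        rescale_line_deriv continuous_on_ray_velocity pos)
  moreover have "?\<gamma> ` {-\<epsilon><..<\<epsilon>} \<subseteq> M"
  proof (rule image_subsetI)
    fix s assume "s \<in> {-\<epsilon><..<\<epsilon>}"
    moreover have "A + s *\<^sub>R v \<in> V"
      using A v by (simp add: M_def subspace_add subspace_scale subspace_V)
    ultimately show "?\<gamma> s \<in> M" using pos rescale_in_M by blast
  qed
  moreover have "?\<gamma> 0 = A" using rescale_id[OF A] by simp
  moreover have "(?\<gamma> has_vector_derivative v) (at 0)"
    using rescale_line_deriv[of A 0 v] A v by (simp add: M_def ray_velocity_def)
  ultimately show "v \<in> tangent_space M A"
    unfolding tangent_space_def using \<epsilon>(1) by blast
qed

section \<open>The Finsler structure\<close>

text \<open>If no coordinate of \<open>v\<close> in \<open>J\<close> were positive,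
  \<open>- v\<close> would be nonnegative with a positive coordinate, and \<open>h'_pos\<close>
  would contradict \<open>h' A v = 0\<close>.\<close>

lemma tangent_MAX_pos:
  assumes A: "A \<in> M" and v: "v \<in> V" "h' A v = 0" "v \<noteq> 0"
  shows "0 < (MAX p\<in>J. v $ p / A $ p)"
proof -
  have "\<exists>p\<in>J. 0 < v $ p"
  proof (rule ccontr)
    assume "\<not> ?thesis"
    then have le: "\<forall>p\<in>J. 0 \<le> (- v) $ p" by force
    obtain p where "v $ p \<noteq> 0" using v(3) by (auto simp: vec_eq_iff)
    then have "p \<in> J" using v(1) V_coord unfolding coord_space_def by blast
    moreover have "0 < (- v) $ p" using le \<open>p \<in> J\<close> \<open>v $ p \<noteq> 0\<close> by force
    ultimately have "0 < h' A (- v)" using A le by (intro h'_pos) (auto simp: M_def)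
    moreover have "h' A (- v) = - h' A v"
      using h_deriv[of A] A by (simp add: M_def has_derivative_linear linear_neg)
    ultimately show False using v(2) by simp
  qed
  then obtain p where p: "p \<in> J" "0 < v $ p" by blast
  then have "0 < v $ p / A $ p" using M_pos[OF A] by simp
  also have "\<dots> \<le> (MAX p\<in>J. v $ p / A $ p)" using p by (intro Max_ge) auto
  finally show ?thesis .
qed

lemma MAX_scale:
  assumes "0 < s"
  shows "(MAX p\<in>J. (s *\<^sub>R v) $ p / A $ p) = s * (MAX p\<in>J. v $ p / A $ p)"
proof -
  obtain p where p: "p \<in> J" "\<And>x. x \<in> J \<Longrightarrow> v $ x / A $ x \<le> v $ p / A $ p"
    using MAX_attained[OF J_nonempty, of "\<lambda>x. v $ x / A $ x"] by blast
  have "(s *\<^sub>R v) $ x / A $ x \<le> (s *\<^sub>R v) $ p / A $ p" if "x \<in> J" for x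
    using mult_left_mono[OF p(2)[OF that], of s] assms by simp
  from MAX_eqI[of p J "\<lambda>x. (s *\<^sub>R v) $ x / A $ x", OF p(1) this]
    MAX_eqI[of p J "\<lambda>x. v $ x / A $ x", OF p] show ?thesis by simp
qed

lemma MAX_convex:
  assumes "s \<in> {0..1}"
  shows "(MAX p\<in>J. (s *\<^sub>R v + (1 - s) *\<^sub>R w) $ p / A $ p)
    \<le> s * (MAX p\<in>J. v $ p / A $ p) + (1 - s) * (MAX p\<in>J. w $ p / A $ p)"
proof (rule Max.boundedI)
  fix y assume "y \<in> (\<lambda>p. (s *\<^sub>R v + (1 - s) *\<^sub>R w) $ p / A $ p) ` J"
  then obtain p where p: "p \<in> J"
    and y: "y = s * (v $ p / A $ p) + (1 - s) * (w $ p / A $ p)"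
    by (auto simp: add_divide_distrib)
  have "v $ p / A $ p \<le> (MAX p\<in>J. v $ p / A $ p)" "w $ p / A $ p \<le> (MAX p\<in>J. w $ p / A $ p)"
    using p by auto
  then show "y \<le> s * (MAX p\<in>J. v $ p / A $ p) + (1 - s) * (MAX p\<in>J. w $ p / A $ p)"
    unfolding y using assms by (intro add_mono mult_left_mono) auto
qed (use J_nonempty in auto)

lemma minkowski_norm_F_a:
  assumes A: "A \<in> M" and t: "t \<in> {0..1}"
  shows "minkowski_norm (tangent_space M A) (F_a J t A)"
proof -
  have lin: "linear (h' A)" using h_deriv[of A] A by (simp add: M_def has_derivative_linear)
  have sub: "subspace (tangent_space M A)"
    using subspace_V unfolding tangent_space_M[OF A] subspace_def
    by (auto simp: linear_0[OF lin] linear_add[OF lin] linear_scale[OF lin])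
  have pos: "0 < F_a J t A v" if "v \<in> tangent_space M A" "v \<noteq> 0" for v
  proof -
    \<comment> \<open>With \<open>v\<close> also \<open>- v\<close> is tangent, so both maxima are
      positive. One of the weights \<open>t\<close> and \<open>1 - t\<close> may vanish, but never
      both.\<close>
    have "- v \<in> tangent_space M A" using sub that by (simp add: subspace_neg)
    then have "0 < (MAX p\<in>J. v $ p / A $ p)" "0 < (MAX p\<in>J. (- v) $ p / A $ p)"
      using that by (auto simp: tangent_space_M[OF A] intro!: tangent_MAX_pos[OF A]
          simp del: vector_uminus_component)
    then show ?thesis
      unfolding F_a_MAX using t
      by (cases "t = 0") (auto intro!: add_nonneg_pos simp del: vector_uminus_component)
  qed
  have zero: "F_a J t A 0 = 0" using J_nonempty by (simp add: F_a_def)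
  have scale: "F_a J t A (s *\<^sub>R v) = s * F_a J t A v" if "0 < s" for s v
    using MAX_scale[OF that, of v A] MAX_scale[OF that, of "- v" A]
    unfolding F_a_MAX by (simp add: algebra_simps)
  have convex: "F_a J t A (s *\<^sub>R v + (1 - s) *\<^sub>R w) \<le> s * F_a J t A v + (1 - s) * F_a J t A w"
    if s: "s \<in> {0..1}" for s v w
  proof -
    have neg: "- (s *\<^sub>R v + (1 - s) *\<^sub>R w) = s *\<^sub>R (- v) + (1 - s) *\<^sub>R (- w)" by simp
    have "F_a J t A (s *\<^sub>R v + (1 - s) *\<^sub>R w)
      \<le> (1 - t) * (s * (MAX p\<in>J. v $ p / A $ p) + (1 - s) * (MAX p\<in>J. w $ p / A $ p))
        + t * (s * (MAX p\<in>J. (- v) $ p / A $ p) + (1 - s) * (MAX p\<in>J. (- w) $ p / A $ p))"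
      unfolding F_a_MAX neg using t by (intro add_mono mult_left_mono MAX_convex s) auto
    also have "\<dots> = s * F_a J t A v + (1 - s) * F_a J t A w"
      unfolding F_a_MAX by (simp add: algebra_simps)
    finally show ?thesis .
  qed
  show ?thesis
    unfolding minkowski_norm_def
  proof (intro conjI ballI allI impI sub)
    fix v assume v: "v \<in> tangent_space M A"
    show "0 \<le> F_a J t A v" "F_a J t A v = 0 \<longleftrightarrow> v = 0"
      using pos[OF v] zero by (cases "v = 0"; force)+
  qed (simp_all add: scale convex)
qed

lemma finsler_structure_F_a:
  assumes "t \<in> {0..1}" shows "finsler_structure M (F_a J t)"
  unfolding finsler_structure_def case_prod_unfold
  using minkowski_norm_F_a assms
  by (auto intro!: continuous_on_F_a continuous_intros simp: M_def)

section \<open>The lower bound for lengths\<close>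

lemma ln_coord_deriv:
  assumes "(c has_vector_derivative v) (at u within X)" "0 < c u $ p"
  shows "((\<lambda>u. ln (c u $ p)) has_real_derivative v $ p / c u $ p) (at u within X)"
proof -
  have "((\<lambda>u. c u $ p) has_real_derivative v $ p) (at u within X)"
    using bounded_linear.has_vector_derivative[OF bounded_linear_vec_nth assms(1)]
    by (simp add: has_real_derivative_iff_has_vector_derivative)
  then show ?thesis
    using assms(2) by (auto intro!: derivative_eq_intros simp: field_simps)
qed

text \<open>For fixed indices \<open>p\<close> and \<open>q\<close> the integrand is an exact
  derivative, so its integral depends only on the end points. It bounds the Finsler norm from below
  along every curve and equals it along the rescaled segment when \<open>p\<close> and
  \<open>q\<close> are the extremal indices.\<close>

lemma ln_coords_has_integral:
  assumes "a \<le> b" "p \<in> J" "q \<in> J"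
    and c': "\<And>u. u \<in> {a..b} \<Longrightarrow> (c has_vector_derivative c' u) (at u within {a..b})"
    and cM: "c ` {a..b} \<subseteq> M"
  shows "((\<lambda>u. (1 - t) * (c' u $ p / c u $ p) + t * (- c' u $ q / c u $ q)) has_integral
    ((1 - t) * ln (c b $ p) - t * ln (c b $ q)) - ((1 - t) * ln (c a $ p) - t * ln (c a $ q))) {a..b}"
proof (rule fundamental_theorem_of_calculus[OF assms(1)])
  fix u assume u: "u \<in> {a..b}"
  then have "0 < c u $ p" "0 < c u $ q" using cM M_pos assms(2,3) by blast+
  from DERIV_diff[OF DERIV_cmult[OF ln_coord_deriv[OF c'[OF u] this(1)], of "1 - t"]
      DERIV_cmult[OF ln_coord_deriv[OF c'[OF u] this(2)], of t]]
  show "((\<lambda>u. (1 - t) * ln (c u $ p) - t * ln (c u $ q)) has_vector_derivative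
      (1 - t) * (c' u $ p / c u $ p) + t * (- c' u $ q / c u $ q)) (at u within {a..b})"
    by (simp add: has_real_derivative_iff_has_vector_derivative)
qed

lemma F_a_ge:
  assumes "t \<in> {0..1}" "p \<in> J" "q \<in> J"
  shows "(1 - t) * (v $ p / A $ p) + t * (- v $ q / A $ q) \<le> F_a J t A v"
  unfolding F_a_def using assms by (intro add_mono mult_left_mono Max_ge) auto

text \<open>The extremal indices are recorded with denominators cleared, the form to which the
  comparisons along the rescaled segment reduce.\<close>

lemma eta_a_attained:
  assumes A: "A \<in> M" and B: "B \<in> M"
  obtains p q where "p \<in> J" "q \<in> J"
    "\<And>x. x \<in> J \<Longrightarrow> B $ x * A $ p \<le> B $ p * A $ x"
    "\<And>x. x \<in> J \<Longrightarrow> A $ x * B $ q \<le> A $ q * B $ x"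
proof -
  obtain p where p: "p \<in> J" "\<And>x. x \<in> J \<Longrightarrow> B $ x / A $ x \<le> B $ p / A $ p"
    using MAX_attained[OF J_nonempty, of "\<lambda>x. B $ x / A $ x"] by blast
  obtain q where q: "q \<in> J" "\<And>x. x \<in> J \<Longrightarrow> A $ x / B $ x \<le> A $ q / B $ q"
    using MAX_attained[OF J_nonempty, of "\<lambda>x. A $ x / B $ x"] by blast
  show thesis
  proof
    show "B $ x * A $ p \<le> B $ p * A $ x" if "x \<in> J" for x
      using p(2)[OF that] M_pos[OF A p(1)] M_pos[OF A that] by (simp add: divide_simps)
    show "A $ x * B $ q \<le> A $ q * B $ x" if "x \<in> J" for x
      using q(2)[OF that] M_pos[OF B q(1)] M_pos[OF B that] by (simp add: divide_simps)
  qed (rule p q)+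
qed

lemma eta_eq:
  assumes "A \<in> pos" "B \<in> pos" "p \<in> J"
    and "\<And>x. x \<in> J \<Longrightarrow> B $ x * A $ p \<le> B $ p * A $ x"
  shows "eta J A B = ln (B $ p) - ln (A $ p)"
proof -
  have "(MAX x\<in>J. B $ x / A $ x) = B $ p / A $ p"
    by (rule MAX_eqI) (use assms in \<open>auto simp: divide_simps\<close>)
  moreover have "0 < A $ p" "0 < B $ p" using assms by auto
  ultimately show ?thesis
    by (simp add: eta_def ln_div)
qed

text \<open>The right side is the increment from \<open>A\<close> to \<open>B\<close> of the
  primitive in \<open>ln_coords_has_integral\<close>.\<close>

lemma eta_a_eq:
  assumes "A \<in> M" "B \<in> M"
    and "p \<in> J" "\<And>x. x \<in> J \<Longrightarrow> B $ x * A $ p \<le> B $ p * A $ x"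
    and "q \<in> J" "\<And>x. x \<in> J \<Longrightarrow> A $ x * B $ q \<le> A $ q * B $ x"
  shows "eta_a J t A B =
    ((1 - t) * ln (B $ p) - t * ln (B $ q)) - ((1 - t) * ln (A $ p) - t * ln (A $ q))"
proof -
  have "A \<in> pos" "B \<in> pos" using assms(1,2) by (auto simp: M_def)
  then have eq: "eta J A B = ln (B $ p) - ln (A $ p)" "eta J B A = ln (A $ q) - ln (B $ q)"
    using assms(3-6) by (simp_all add: eta_eq del: mem_Collect_eq)
  show ?thesis unfolding eta_a_def eq by (simp add: algebra_simps)
qed

text \<open>The indices \<open>p\<close> and \<open>q\<close> are chosen for the end points and kept
  fixed along \<open>c\<close>. At each time the norm dominates the derivative of \<open>G\<close>
  by \<open>F_a_ge\<close>, and the total increment of \<open>G\<close> is the distance.\<close>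

lemma eta_a_le_finsler_length:
  assumes A: "A \<in> M" and B: "B \<in> M" and t: "t \<in> {0..1}" and c: "c \<in> curves_between M A B"
  shows "eta_a J t A B \<le> finsler_length (F_a J t) c"
proof -
  obtain p q where p: "p \<in> J" "\<And>x. x \<in> J \<Longrightarrow> B $ x * A $ p \<le> B $ p * A $ x"
    and q: "q \<in> J" "\<And>x. x \<in> J \<Longrightarrow> A $ x * B $ q \<le> A $ q * B $ x"
    using eta_a_attained[OF A B] by metis
  define G where "G u = (1 - t) * ln (c u $ p) - t * ln (c u $ q)" for u
  let ?f = "\<lambda>s. F_a J t (c s) (vector_derivative c (at s within {0..1}))"
  have cM: "c ` {0..1} \<subseteq> M" and c01: "c 0 = A" "c 1 = B"
    using c by (auto simp: curves_between_def)
  obtain n :: nat and s where s: "s 0 = 0" "s n = 1" "\<And>m. m < n \<Longrightarrow> s m < s (Suc m)"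
    and pieces: "\<And>m. m < n \<Longrightarrow> \<exists>c'. continuous_on {s m..s (Suc m)} c' \<and>
           (\<forall>u\<in>{s m..s (Suc m)}. (c has_vector_derivative c' u) (at u within {s m..s (Suc m)}))"
    using c unfolding curves_between_def piecewise_C1_def by auto
  have mono: "s m \<le> s k" if "m \<le> k" "k \<le> n" for m k
    using that
  proof (induction k rule: dec_induct)
    case (step k)
    then show ?case using s(3)[of k] by force
  qed simp
  \<comment> \<open>The induction over the pieces carries integrability along with the bound, since
    the value of \<open>integral\<close> is informative only for integrable functions.\<close>
  have "m \<le> n \<Longrightarrow> \<exists>I. (?f has_integral I) {0..s m} \<and> G (s m) - G 0 \<le> I" for m
  proof (induction m)
    case 0
    show ?case using s(1) by (auto intro: has_integral_refl(2))
  next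
    case (Suc m)
    then obtain I where I: "(?f has_integral I) {0..s m}" "G (s m) - G 0 \<le> I" by auto
    have le: "s m \<le> s (Suc m)" and sub: "{s m..s (Suc m)} \<subseteq> {0..1}"
      using Suc.prems mono[of m "Suc m"] mono[of 0 m] mono[of "Suc m" n] s(1,2) by auto
    then have cM': "c ` {s m..s (Suc m)} \<subseteq> M" using cM by blast
    obtain c' where c'cont: "continuous_on {s m..s (Suc m)} c'"
      and c': "\<And>u. u \<in> {s m..s (Suc m)} \<Longrightarrow>
        (c has_vector_derivative c' u) (at u within {s m..s (Suc m)})"
      using pieces[of m] Suc.prems by auto
    have "continuous_on {s m..s (Suc m)} c"
      using c' by (meson continuous_on_vector_derivative)
    then have cont: "continuous_on {s m..s (Suc m)} (\<lambda>u. F_a J t (c u) (c' u))"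
    proof (rule continuous_on_F_a[OF _ c'cont])
      show "c u \<in> pos" if "u \<in> {s m..s (Suc m)}" for u
        using that cM' M_pos by blast
    qed
    let ?I = "integral {s m..s (Suc m)} (\<lambda>u. F_a J t (c u) (c' u))"
    have f: "(?f has_integral ?I) {s m..s (Suc m)}"
      by (rule finsler_integrand_has_integral[OF c' cont sub])
    have "G (s (Suc m)) - G (s m) \<le> ?I"
      unfolding G_def
      by (rule has_integral_le[OF ln_coords_has_integral[OF le p(1) q(1) c' cM']
            integrable_integral[OF integrable_continuous_real[OF cont]]])
        (assumption, rule F_a_ge[OF t p(1) q(1)])
    moreover have "(?f has_integral I + ?I) {0..s (Suc m)}"
      using has_integral_combine[OF _ le I(1) f] mono[of 0 m] Suc.prems s(1) by auto
    ultimately show ?case using I(2) by force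
  qed
  from this[of n] obtain I where I: "(?f has_integral I) {0..1}" "G 1 - G 0 \<le> I"
    using s(2) by auto
  have "eta_a J t A B = G 1 - G 0"
    unfolding G_def c01 by (rule eta_a_eq[OF A B p q])
  also have "\<dots> \<le> finsler_length (F_a J t) c"
    unfolding finsler_length_def using I by (simp add: integral_unique)
  finally show ?thesis .
qed

section \<open>Rescaled segments as bigeodesics of minimal length\<close>

definition geod :: "real^('e \<times> 'e \<times> 'e) \<Rightarrow> real^('e \<times> 'e \<times> 'e) \<Rightarrow> real \<Rightarrow> real^('e \<times> 'e \<times> 'e)" where
  "geod A B s = rescale (A + s *\<^sub>R (B - A))"

context
  fixes A B assumes A: "A \<in> M" and B: "B \<in> M"
begin

lemma segment_pos:
  assumes "s \<in> {0..1}" shows "A + s *\<^sub>R (B - A) \<in> pos"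
proof -
  have "0 < A $ p + s * (B $ p - A $ p)" if "p \<in> J" for p
  proof -
    have "0 < A $ p" "0 < B $ p" using M_pos A B that by auto
    then have "0 < (1 - s) * A $ p + s * B $ p"
      using assms by (cases "s = 0") (auto intro!: add_nonneg_pos)
    then show ?thesis by (simp add: algebra_simps)
  qed
  then show ?thesis by simp
qed

lemma geod_in_M: "s \<in> {0..1} \<Longrightarrow> geod A B s \<in> M"
  unfolding geod_def using A B segment_pos
  by (intro rescale_in_M) (auto simp: M_def subspace_add subspace_diff subspace_scale subspace_V)

lemma geod_ends: "geod A B 0 = A" "geod A B 1 = B"
  using A B rescale_id by (auto simp: geod_def)

lemma geod_deriv:
  "s \<in> {0..1} \<Longrightarrow>
    (geod A B has_vector_derivative ray_velocity (A + s *\<^sub>R (B - A)) (B - A)) (at s)"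
  unfolding geod_def[abs_def] using rescale_line_deriv segment_pos by blast

lemma continuous_on_geod: "continuous_on {0..1} (geod A B)"
  by (rule continuous_on_vector_derivative) (rule has_vector_derivative_at_within[OF geod_deriv])

text \<open>The factor \<open>w - u\<close> in the hypothesis covers both directions of travel: the maximal index
  for \<open>u \<le> w\<close>, the minimal one for \<open>w \<le> u\<close>.\<close>

lemma eta_geod:
  assumes uw: "u \<in> {0..1}" "w \<in> {0..1}" and "p \<in> J"
    and p: "\<And>x. x \<in> J \<Longrightarrow> (w - u) * (B $ x * A $ p) \<le> (w - u) * (B $ p * A $ x)"
  shows "eta J (geod A B u) (geod A B w) = ln (geod A B w $ p) - ln (geod A B u $ p)"
proof (rule eta_eq)
  show "geod A B u \<in> pos" "geod A B w \<in> pos" using geod_in_M uw by (auto simp: M_def)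
  fix x assume x: "x \<in> J"
  have "0 < h (A + u *\<^sub>R (B - A))" "0 < h (A + w *\<^sub>R (B - A))"
    using h_pos segment_pos uw by auto
  \<comment> \<open>The terms in \<open>u * w\<close> cancel, and the two sides differ by exactly
    \<open>(w - u) * (B $ p * A $ x - B $ x * A $ p)\<close>. The normalising factors are common to
    both sides of the goal.\<close>
  moreover have
    "(A $ x + w * (B $ x - A $ x)) * (A $ p + u * (B $ p - A $ p))
      \<le> (A $ p + w * (B $ p - A $ p)) * (A $ x + u * (B $ x - A $ x))"
    using p[OF x] by (simp add: algebra_simps)
  ultimately show "geod A B w $ x * geod A B u $ p \<le> geod A B w $ p * geod A B u $ x"
    by (simp add: geod_def rescale_def divide_simps mult_ac)
qed fact

text \<open>The indices \<open>p\<close> and \<open>q\<close> found for the end points are extremal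
  for every pair of points of the segment. The distance is therefore an increment of one function of
  the parameter, and increments add up.\<close>

lemma geod_bigeodesic: "bigeodesic M (eta_a J t) 0 1 (geod A B)"
proof -
  obtain p q where p: "p \<in> J" "\<And>x. x \<in> J \<Longrightarrow> B $ x * A $ p \<le> B $ p * A $ x"
    and q: "q \<in> J" "\<And>x. x \<in> J \<Longrightarrow> A $ x * B $ q \<le> A $ q * B $ x"
    using eta_a_attained[OF A B] by metis
  let ?\<alpha> = "geod A B"
  \<comment> \<open>Proved for every \<open>t\<close>, because reversing the path replaces
    \<open>t\<close> by \<open>1 - t\<close> (\<open>eta_a_swap\<close>).\<close>
  have fwd: "eta_a J t (?\<alpha> u) (?\<alpha> w) =
      (1 - t) * (ln (?\<alpha> w $ p) - ln (?\<alpha> u $ p)) + t * (ln (?\<alpha> u $ q) - ln (?\<alpha> w $ q))"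
    if "0 \<le> u" "u \<le> w" "w \<le> 1" for u w t
  proof -
    have "eta J (?\<alpha> u) (?\<alpha> w) = ln (?\<alpha> w $ p) - ln (?\<alpha> u $ p)"
      by (rule eta_geod) (use that p in \<open>auto intro: mult_left_mono\<close>)
    moreover have "eta J (?\<alpha> w) (?\<alpha> u) = ln (?\<alpha> u $ q) - ln (?\<alpha> w $ q)"
    proof (rule eta_geod)
      show "(u - w) * (B $ x * A $ q) \<le> (u - w) * (B $ q * A $ x)" if "x \<in> J" for x
        using q(2)[OF that] \<open>u \<le> w\<close> by (intro mult_left_mono_neg) (auto simp: mult_ac)
    qed (use that q in auto)
    ultimately show ?thesis by (simp add: eta_a_def)
  qed
  have eta_refl: "eta_a J t C C = 0" if "C \<in> M" for t C
    using that p(1) eta_eq[of C C p] by (simp add: eta_a_def M_def)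
  \<comment> \<open>Continuity in the Euclidean topology suffices: \<open>eta\<close> is continuous
    on positive vectors and \<open>eta_a\<close> vanishes on the diagonal of
    \<open>M\<close>.\<close>
  have cont: "continuous_path M (eta_a J t) 0 1 c"
    if "continuous_on {0..1} c" "c ` {0..1} \<subseteq> M" for c t
    unfolding continuous_path_def
  proof (intro conjI ballI allI impI that)
    fix u \<epsilon> :: real assume u: "u \<in> {0..1}" and "0 < \<epsilon>"
    have pos: "c v \<in> pos" if "v \<in> {0..1}" for v
      using that \<open>c ` {0..1} \<subseteq> M\<close> M_pos by blast
    have "continuous_on {0..1} (\<lambda>v. eta J (c u) (c v))"
      by (rule continuous_on_eta[OF continuous_on_const that(1) pos[OF u] pos])
    moreover have "continuous_on {0..1} (\<lambda>v. eta J (c v) (c u))"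
      by (rule continuous_on_eta[OF that(1) continuous_on_const pos pos[OF u]])
    ultimately have
      "continuous_on {0..1} (\<lambda>v. max (eta_a J t (c u) (c v)) (eta_a J t (c v) (c u)))"
      unfolding eta_a_def by (intro continuous_intros)
    from this[unfolded continuous_on_iff, rule_format, OF u \<open>0 < \<epsilon>\<close>]
    obtain \<delta> where \<delta>: "0 < \<delta>" and close: "\<And>v. v \<in> {0..1} \<Longrightarrow> dist v u < \<delta> \<Longrightarrow>
        dist (max (eta_a J t (c u) (c v)) (eta_a J t (c v) (c u)))
             (max (eta_a J t (c u) (c u)) (eta_a J t (c u) (c u))) < \<epsilon>"
      by blast
    have "eta_a J t (c u) (c u) = 0" using eta_refl that u by blast
    then show "\<exists>\<delta>>0. \<forall>v\<in>{0..1}. \<bar>v - u\<bar> < \<delta> \<longrightarrow>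
        max (eta_a J t (c u) (c v)) (eta_a J t (c v) (c u)) < \<epsilon>"
      using close by (intro exI[of _ \<delta>] conjI \<delta> ballI impI) (fastforce simp: dist_real_def)
  qed
  have "geodesic M (eta_a J t) 0 1 ?\<alpha>"
    unfolding geodesic_def using geod_in_M
    by (auto intro!: cont continuous_on_geod simp: fwd algebra_simps)
  moreover have "geodesic M (eta_a J t) 0 1 (\<lambda>u. ?\<alpha> (0 + 1 - u))"
    unfolding geodesic_def
  proof (intro conjI allI impI cont)
    show "continuous_on {0..1} (\<lambda>u. ?\<alpha> (0 + 1 - u))"
      by (rule continuous_on_compose2[OF continuous_on_geod]) (auto intro!: continuous_intros)
    show "(\<lambda>u. ?\<alpha> (0 + 1 - u)) ` {0..1} \<subseteq> M" using geod_in_M by auto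
    fix u v w :: real assume "0 \<le> u \<and> u \<le> v \<and> v \<le> w \<and> w \<le> 1"
    then show "eta_a J t (?\<alpha> (0 + 1 - u)) (?\<alpha> (0 + 1 - w)) =
        eta_a J t (?\<alpha> (0 + 1 - u)) (?\<alpha> (0 + 1 - v)) + eta_a J t (?\<alpha> (0 + 1 - v)) (?\<alpha> (0 + 1 - w))"
      by (simp add: eta_a_swap[of J t "?\<alpha> (1 - _)"] fwd algebra_simps)
  qed
  ultimately show ?thesis by (simp add: bigeodesic_def)
qed

lemma geod_curve: "geod A B \<in> curves_between M A B"
proof -
  \<comment> \<open>A single piece is enough; the function \<open>real\<close> supplies its break
    points 0 and 1.\<close>
  have "piecewise_C1 (geod A B) 0 1"
    unfolding piecewise_C1_def
  proof (intro exI[of _ 1] exI[of _ "real"] conjI allI impI)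
    fix m :: nat assume "m < 1"
    then show "\<exists>c'. continuous_on {real m..real (Suc m)} c' \<and> (\<forall>u\<in>{real m..real (Suc m)}.
        (geod A B has_vector_derivative c' u) (at u within {real m..real (Suc m)}))"
      by (intro exI[of _ "\<lambda>s. ray_velocity (A + s *\<^sub>R (B - A)) (B - A)"])
        (auto intro!: continuous_on_ray_velocity segment_pos has_vector_derivative_at_within[OF geod_deriv]
          simp del: mem_Collect_eq)
  qed auto
  then show ?thesis using geod_in_M geod_ends by (auto simp: curves_between_def)
qed

text \<open>Rescaling changes the logarithmic derivatives of all coordinates by the same amount.
  Which coordinate is extremal can thus be decided on the straight segment.\<close>

lemma ray_velocity_quotient:
  assumes s: "s \<in> {0..1}" and "x \<in> J"
  shows "ray_velocity (A + s *\<^sub>R (B - A)) (B - A) $ x / geod A B s $ x =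
    (B $ x - A $ x) / (A $ x + s * (B $ x - A $ x))
      - h' (A + s *\<^sub>R (B - A)) (B - A) / (2 * h (A + s *\<^sub>R (B - A)))"
proof -
  have "0 < A $ x + s * (B $ x - A $ x)" "0 < h (A + s *\<^sub>R (B - A))"
    using segment_pos[OF s] h_pos assms(2) by auto
  moreover have "((1 / r) * (b - k * l)) / ((1 / r) * l) = b / l - k"
    if "0 < r" "0 < l" for r b k l :: real
    using that by (simp add: field_simps)
  ultimately show ?thesis
    by (simp only: ray_velocity_def geod_def rescale_def vector_scaleR_component
        vector_minus_component vector_add_component real_scaleR_def real_sqrt_gt_zero)
qed

text \<open>At every time both maxima in the norm are attained at the indices \<open>p\<close> and
  \<open>q\<close> of the end points, so the estimate behind \<open>eta_a_le_finsler_length\<close>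
  becomes an equality.\<close>

lemma geod_length:
  assumes t: "t \<in> {0..1}"
  shows "finsler_length (F_a J t) (geod A B) = eta_a J t A B"
proof -
  obtain p q where p: "p \<in> J" "\<And>x. x \<in> J \<Longrightarrow> B $ x * A $ p \<le> B $ p * A $ x"
    and q: "q \<in> J" "\<And>x. x \<in> J \<Longrightarrow> A $ x * B $ q \<le> A $ q * B $ x"
    using eta_a_attained[OF A B] by metis
  let ?\<alpha> = "geod A B"
  let ?\<alpha>' = "\<lambda>s. ray_velocity (A + s *\<^sub>R (B - A)) (B - A)"
  have D: "(?\<alpha> has_vector_derivative ?\<alpha>' s) (at s within {0..1})" if "s \<in> {0..1}" for s
    using geod_deriv[OF that] by (rule has_vector_derivative_at_within)
  have F: "F_a J t (?\<alpha> s) (?\<alpha>' s) =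
      (1 - t) * (?\<alpha>' s $ p / ?\<alpha> s $ p) + t * (- ?\<alpha>' s $ q / ?\<alpha> s $ q)" if s: "s \<in> {0..1}" for s
  proof -
    have pos: "0 < A $ x + s * (B $ x - A $ x)" if "x \<in> J" for x
      using segment_pos[OF s] that by auto
    have "(MAX x\<in>J. ?\<alpha>' s $ x / ?\<alpha> s $ x) = ?\<alpha>' s $ p / ?\<alpha> s $ p"
    proof (rule MAX_eqI[OF p(1)])
      fix x assume x: "x \<in> J"
      \<comment> \<open>After cross multiplication \<open>s\<close> drops out, and the inequality
        that remains is the extremality of \<open>p\<close>.\<close>
      have "(B $ x - A $ x) / (A $ x + s * (B $ x - A $ x))
          \<le> (B $ p - A $ p) / (A $ p + s * (B $ p - A $ p))"
        using p(2)[OF x] by (simp add: divide_le_divide_iff pos x p(1)) (simp add: algebra_simps)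
      then show "?\<alpha>' s $ x / ?\<alpha> s $ x \<le> ?\<alpha>' s $ p / ?\<alpha> s $ p"
        by (simp add: ray_velocity_quotient[OF s] x p(1))
    qed
    moreover have "(MAX x\<in>J. - ?\<alpha>' s $ x / ?\<alpha> s $ x) = - ?\<alpha>' s $ q / ?\<alpha> s $ q"
    proof (rule MAX_eqI[OF q(1)])
      fix x assume x: "x \<in> J"
      have "(B $ q - A $ q) / (A $ q + s * (B $ q - A $ q))
          \<le> (B $ x - A $ x) / (A $ x + s * (B $ x - A $ x))"
        using q(2)[OF x] by (simp add: divide_le_divide_iff pos x q(1)) (simp add: algebra_simps)
      then show "- ?\<alpha>' s $ x / ?\<alpha> s $ x \<le> - ?\<alpha>' s $ q / ?\<alpha> s $ q"
        by (simp add: ray_velocity_quotient[OF s] x q(1))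
    qed
    ultimately show ?thesis by (simp add: F_a_def)
  qed
  have cont: "continuous_on {0..1} (\<lambda>s. F_a J t (?\<alpha> s) (?\<alpha>' s))"
    by (rule continuous_on_F_a[OF continuous_on_geod continuous_on_ray_velocity[OF segment_pos]])
      (use geod_in_M in \<open>auto simp: M_def\<close>)
  have "?\<alpha> ` {0..1} \<subseteq> M" using geod_in_M by blast
  from ln_coords_has_integral[OF zero_le_one p(1) q(1) D this, of t]
  have "((\<lambda>s. F_a J t (?\<alpha> s) (?\<alpha>' s)) has_integral
      ((1 - t) * ln (B $ p) - t * ln (B $ q)) - ((1 - t) * ln (A $ p) - t * ln (A $ q))) {0..1}"
    by (subst has_integral_cong[OF F]) (simp_all add: geod_ends)
  moreover have "((1 - t) * ln (B $ p) - t * ln (B $ q)) - ((1 - t) * ln (A $ p) - t * ln (A $ q))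
      = eta_a J t A B"
    by (rule eta_a_eq[OF A B p q, symmetric])
  ultimately show ?thesis
    using finsler_integrand_has_integral[OF D cont order_refl]
    by (simp add: finsler_length_def integral_unique)
qed

end

text \<open>The infimum is a minimum, attained by the rescaled segment.\<close>

lemma induced_by_finsler_eta_a:
  assumes t: "t \<in> {0..1}"
  shows "induced_by_finsler M (F_a J t) (eta_a J t)"
  unfolding induced_by_finsler_def
proof (intro conjI ballI finsler_structure_F_a t)
  fix A B assume A: "A \<in> M" and B: "B \<in> M"
  show "eta_a J t A B = (INF c\<in>curves_between M A B. finsler_length (F_a J t) c)"
  proof (rule cInf_eq_minimum[symmetric])
    show "eta_a J t A B \<in> finsler_length (F_a J t) ` curves_between M A B"
      using geod_curve[OF A B] geod_length[OF A B t] by (metis image_eqI)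
  qed (auto intro: eta_a_le_finsler_length[OF A B t])
qed

end

section \<open>Heron's formula and its derivative\<close>

definition heron :: "'e \<times> 'e \<times> 'e \<Rightarrow> real^('e::finite \<times> 'e \<times> 'e) \<Rightarrow> real" where
  "heron = (\<lambda>(i,j,k) A. sqrt ((A $ (i,j,k) + A $ (j,k,i) + A $ (k,i,j)) *
     A $ (i,j,k) * A $ (j,k,i) * A $ (k,i,j)))"

text \<open>The chain rule for the square root: the numerator is the differential of the radicand
  \<open>(a + b + c) * a * b * c\<close>, whose partial derivative in \<open>a\<close> is
  \<open>b * c * (2 * a + b + c)\<close>. All three coefficients are positive on positive
  triples.\<close>

definition heron_deriv ::
  "'e \<times> 'e \<times> 'e \<Rightarrow> real^('e::finite \<times> 'e \<times> 'e) \<Rightarrow> real^('e \<times> 'e \<times> 'e) \<Rightarrow> real" where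
  "heron_deriv = (\<lambda>(i,j,k) A v. let a = A $ (i,j,k); b = A $ (j,k,i); c = A $ (k,i,j) in
     (b * c * (2 * a + b + c) * v $ (i,j,k) + a * c * (a + 2 * b + c) * v $ (j,k,i)
       + a * b * (a + b + 2 * c) * v $ (k,i,j)) / (2 * heron (i,j,k) A))"

lemma heron_radicand_pos:
  fixes a b c :: real
  assumes "0 < a" "0 < b" "0 < c" shows "0 < (a + b + c) * a * b * c"
  using assms by simp

lemma heron_pos:
  assumes "0 < A $ (i,j,k)" "0 < A $ (j,k,i)" "0 < A $ (k,i,j)"
  shows "0 < heron (i,j,k) A"
  using heron_radicand_pos[OF assms] by (simp add: heron_def)

lemma heron_scale: "0 \<le> r \<Longrightarrow> heron p (r *\<^sub>R A) = r\<^sup>2 * heron p A"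
proof (cases p)
  case (fields i j k)
  assume "0 \<le> r"
  let ?Q = "(A $ (i,j,k) + A $ (j,k,i) + A $ (k,i,j)) * A $ (i,j,k) * A $ (j,k,i) * A $ (k,i,j)"
  \<comment> \<open>The radicand has degree four; writing the factor as a square lets the root
    return \<open>r\<^sup>2\<close>.\<close>
  have "(r * a + r * b + r * c) * (r * a) * (r * b) * (r * c) = (r\<^sup>2)\<^sup>2 * ((a + b + c) * a * b * c)"
    for a b c :: real by algebra
  then have "heron p (r *\<^sub>R A) = sqrt ((r\<^sup>2)\<^sup>2 * ?Q)"
    unfolding fields heron_def by (simp only: case_prod_conv vector_scaleR_component real_scaleR_def)
  then show ?thesis
    by (simp only: fields heron_def case_prod_conv real_sqrt_mult[of "(r\<^sup>2)\<^sup>2"] real_sqrt_abs abs_power2)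
qed

lemma heron_has_derivative:
  assumes "0 < A $ (i,j,k)" "0 < A $ (j,k,i)" "0 < A $ (k,i,j)"
  shows "(heron (i,j,k) has_derivative heron_deriv (i,j,k) A) (at A)"
proof -
  have D: "((\<lambda>A. A $ p) has_derivative (\<lambda>v. v $ p)) (at A)" for p :: "'a \<times> 'a \<times> 'a"
    by (rule bounded_linear_imp_has_derivative[OF bounded_linear_vec_nth])
  show ?thesis
    unfolding heron_def case_prod_conv
    by (rule derivative_eq_intros D refl heron_radicand_pos[OF assms])+
      (use heron_pos[OF assms] in
        \<open>auto simp: heron_deriv_def heron_def Let_def fun_eq_iff divide_simps algebra_simps\<close>)
qed

lemma continuous_on_heron_deriv:
  assumes "\<And>A. A \<in> X \<Longrightarrow> 0 < A $ (i,j,k)" "\<And>A. A \<in> X \<Longrightarrow> 0 < A $ (j,k,i)"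
    "\<And>A. A \<in> X \<Longrightarrow> 0 < A $ (k,i,j)"
  shows "continuous_on X (\<lambda>A. heron_deriv (i,j,k) A v)"
proof -
  have "2 * heron (i,j,k) A \<noteq> 0" if "A \<in> X" for A
    using heron_pos[of A i j k] assms that by force
  then show ?thesis
    unfolding heron_deriv_def case_prod_conv Let_def
    by (intro continuous_intros) (auto simp: heron_def intro!: continuous_intros)
qed

lemma heron_deriv_nonneg:
  assumes "0 < A $ (i,j,k)" "0 < A $ (j,k,i)" "0 < A $ (k,i,j)"
    and "0 \<le> v $ (i,j,k)" "0 \<le> v $ (j,k,i)" "0 \<le> v $ (k,i,j)"
  shows "0 \<le> heron_deriv (i,j,k) A v"
  unfolding heron_deriv_def case_prod_conv Let_def using assms heron_pos[OF assms(1-3)]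
  by (intro divide_nonneg_pos add_nonneg_nonneg mult_nonneg_nonneg) auto

text \<open>Strict positivity is asked of the first coordinate only: a triple of \<open>J\<close>
  with a positive coordinate of \<open>v\<close> can itself be taken as
  \<open>(i,j,k)\<close>.\<close>

lemma heron_deriv_pos:
  assumes "0 < A $ (i,j,k)" "0 < A $ (j,k,i)" "0 < A $ (k,i,j)"
    and "0 < v $ (i,j,k)" "0 \<le> v $ (j,k,i)" "0 \<le> v $ (k,i,j)"
  shows "0 < heron_deriv (i,j,k) A v"
  unfolding heron_deriv_def case_prod_conv Let_def using assms heron_pos[OF assms(1-3)]
  by (intro divide_pos_pos add_pos_nonneg mult_nonneg_nonneg mult_pos_pos) auto

section \<open>Singular Euclidean metrics as a linear cone\<close>

lemma subspace_range_A_coords: "subspace (range (A_coords J))"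
  unfolding subspace_def
proof (safe intro!: rangeI)
  have "A_coords J (\<lambda>_. 0) = 0" by (auto simp: A_coords_def vec_eq_iff)
  then show "0 \<in> range (A_coords J)" by (metis rangeI)
  fix l m :: "'a \<Rightarrow> real" and r :: real
  have "A_coords J l + A_coords J m = A_coords J (\<lambda>i. l i + m i)"
    by (auto simp: A_coords_def vec_eq_iff field_simps)
  then show "A_coords J l + A_coords J m \<in> range (A_coords J)" by simp
  have "r *\<^sub>R A_coords J l = A_coords J (\<lambda>i. r * l i)"
    by (auto simp: A_coords_def vec_eq_iff field_simps)
  then show "r *\<^sub>R A_coords J l \<in> range (A_coords J)" by simp
qed

text \<open>Permuting barycentric coordinates is a homeomorphism of the standard triangle that
  carries side \<open>n\<close> to side \<open>\<pi> n\<close>, so precomposing with it relabels the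
  edges of the face.\<close>

lemma characteristic_map_permute:
  assumes \<phi>: "characteristic_map S T f \<sigma> \<phi>" and \<pi>: "bij \<pi>"
  shows "characteristic_map S T f (\<sigma> \<circ> \<pi>) (\<phi> \<circ> (\<lambda>x. \<chi> n. x $ inv \<pi> n))"
proof -
  define P :: "real^3 \<Rightarrow> real^3" where "P x = (\<chi> n. x $ inv \<pi> n)" for x
  define Q :: "real^3 \<Rightarrow> real^3" where "Q x = (\<chi> n. x $ \<pi> n)" for x
  have inv: "inv \<pi> (\<pi> n) = n" "\<pi> (inv \<pi> n) = n" for n
    using \<pi> by (simp_all add: bij_is_inj bij_is_surj surj_f_inv_f)
  have PQ: "P (Q x) = x" and QP: "Q (P x) = x" for x
    by (simp_all add: P_def Q_def vec_eq_iff inv)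
  have sums: "(\<Sum>n\<in>UNIV. x $ inv \<pi> n) = (\<Sum>n\<in>UNIV. x $ n)" "(\<Sum>n\<in>UNIV. x $ \<pi> n) = (\<Sum>n\<in>UNIV. x $ n)"
    for x :: "real^3"
    using \<pi> by (simp_all add: sum.reindex_bij_betw bij_imp_bij_inv)
  have tri: "P x \<in> std_triangle \<longleftrightarrow> x \<in> std_triangle" for x
    unfolding std_triangle_def P_def by (simp add: sums) (metis inv)
  have interior: "P x \<in> std_interior \<longleftrightarrow> x \<in> std_interior" for x
    unfolding std_interior_def by (simp add: tri) (simp add: P_def, metis inv)
  have side: "P x \<in> std_side (\<pi> n) \<longleftrightarrow> x \<in> std_side n" for x n
    unfolding std_side_def by (simp add: tri) (simp add: P_def inv)
  have open_side: "P x \<in> std_open_side (\<pi> n) \<longleftrightarrow> x \<in> std_open_side n" for x n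
    unfolding std_open_side_def by (simp add: tri) (simp add: P_def inv, metis inv)
  have image: "P ` X = Y" if "\<And>x. P x \<in> Y \<longleftrightarrow> x \<in> X" for X Y
  proof
    show "P ` X \<subseteq> Y" using that by blast
    show "Y \<subseteq> P ` X" using that[of "Q _"] PQ by (metis image_eqI subsetI)
  qed
  have inj: "inj_on P X" for X by (metis QP inj_onI)
  have axis: "P (axis n 1) = axis (\<pi> n) 1" for n
    by (simp add: P_def axis_def vec_eq_iff) (metis inv)
  note images = image[OF tri] image[OF interior] image[OF side] image[OF open_side]
  have "continuous_on std_triangle P"
    unfolding P_def by (intro continuous_intros)
  then have "continuous_map (top_of_set std_triangle) (top_of_set std_triangle) P"
    using images(1) by (auto simp: continuous_map_in_subtopology)
  then have "continuous_map (top_of_set std_triangle) S (\<phi> \<circ> P)"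
    by (rule continuous_map_compose) (use \<phi> in \<open>simp add: characteristic_map_def\<close>)
  moreover have "inj_on (\<phi> \<circ> P) X" if "inj_on \<phi> (P ` X)" for X
    using inj that by (rule comp_inj_on)
  ultimately have "characteristic_map S T f (\<sigma> \<circ> \<pi>) (\<phi> \<circ> P)"
    using \<phi> unfolding characteristic_map_def image_comp[symmetric] images
    by (simp add: images axis)
  then show ?thesis by (simp add: P_def[abs_def])
qed

text \<open>One transposition is enough to find a triple of \<open>J\<close> that lists the edges of
  a face in the order of a characteristic map, because \<open>J\<close> is closed under
  rotations.\<close>

lemma face_edges_swap:
  assumes "face_edges S T f i j k"
  shows "face_edges S T f j i k"
proof -
  obtain \<sigma> \<phi> where \<phi>: "characteristic_map S T f \<sigma> \<phi>" "\<sigma> 1 = i" "\<sigma> 2 = j" "\<sigma> 3 = k"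
    using assms by (auto simp: face_edges_def)
  from characteristic_map_permute[OF \<phi>(1) bij_transpose[of 1 2]] show ?thesis
    unfolding face_edges_def by (intro exI conjI) (assumption, simp_all add: \<phi>(2-4) transpose_def)
qed

text \<open>Positivity of the coordinates in \<open>J\<close> is the system of strict triangle
  inequalities. Positivity of the lengths follows, since adding the inequalities for
  \<open>l j\<close> and \<open>l k\<close> leaves \<open>0 < 2 * l i\<close>.\<close>

lemma euclidean_metrics_eq_cone:
  assumes T: "is_triangulation S T" and J: "face_triples S T J"
  shows "euclidean_metrics S T J = {A \<in> range (A_coords J). \<forall>p\<in>J. 0 < A $ p}" (is "_ = ?R")
proof
  have cyc: "(j,k,i) \<in> J" "(k,i,j) \<in> J" if "(i,j,k) \<in> J" for i j k
    using J that unfolding face_triples_def by blast+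
  have sub: "\<exists>f\<in>faces T. face_edges S T f i j k" if "(i,j,k) \<in> J" for i j k
    using J that unfolding face_triples_def by blast
  \<comment> \<open>Up to rotation, which preserves membership in \<open>J\<close>, three edges have
    only two orders.\<close>
  have perm: "(i,j,k) \<in> J \<or> (j,i,k) \<in> J"
    if "f \<in> faces T" "face_edges S T f i j k" for f i j k
  proof -
    have "{(i,j,k), (j,k,i), (k,i,j), (j,i,k), (i,k,j), (k,j,i)} \<inter> J \<noteq> {}"
      using J[unfolded face_triples_def, THEN conjunct2, THEN conjunct1] that by simp
    then show ?thesis using cyc by blast
  qed
  show "euclidean_metrics S T J \<subseteq> ?R"
    using sub by (fastforce simp: euclidean_metrics_def edge_lengths_def A_coords_def)
  show "?R \<subseteq> euclidean_metrics S T J"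
  proof
    fix A assume A: "A \<in> ?R"
    then obtain l where l: "A = A_coords J l" by blast
    have lt: "l i < l j + l k" if "(i,j,k) \<in> J" for i j k
    proof -
      have "0 < A $ (i,j,k)" using A that by blast
      then show ?thesis using that by (simp add: l A_coords_def)
    qed
    have pos: "0 < l i" if "(i,j,k) \<in> J" for i j k
      using lt[OF cyc(1)[OF that]] lt[OF cyc(2)[OF that]] by linarith
    have "l \<in> edge_lengths S T"
      unfolding edge_lengths_def
    proof safe
      fix i
      obtain f j k where "f \<in> faces T" "face_edges S T f i j k"
        using T[unfolded is_triangulation_def] by metis
      then have "(i,j,k) \<in> J \<or> (i,k,j) \<in> J" using perm cyc by blast
      then show "0 < l i" using pos by blast
    next
      fix f i j k assume "f \<in> faces T" "face_edges S T f i j k"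
      then have "(i,j,k) \<in> J \<or> (i,k,j) \<in> J" using perm cyc by blast
      then show "l i < l j + l k" using lt by force
    qed
    then show "A \<in> euclidean_metrics S T J"
      unfolding euclidean_metrics_def l by blast
  qed
qed

text \<open>A triple of \<open>J\<close> may occur in several faces, and the triple chosen for a face may be a
  rotation of a given one. Positivity is transported between them by uniqueness of derivatives.\<close>

lemma level_set_area:
  assumes T: "is_triangulation S T" and J: "face_triples S T J"
  shows "\<exists>h'. level_set J (range (A_coords J)) (area S T J) h'"
proof -
  have cyc: "(j,k,i) \<in> J" "(k,i,j) \<in> J" if "(i,j,k) \<in> J" for i j k
    using J that unfolding face_triples_def by blast+
  have face: "\<exists>f\<in>faces T. face_edges S T f i j k" if "(i,j,k) \<in> J" for i j k
    using J that unfolding face_triples_def by blast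
  have fin: "finite (faces T)" using T by (simp add: is_triangulation_def)
  have ne: "faces T \<noteq> {}" using T unfolding is_triangulation_def by (metis empty_iff)
  have "\<exists>i j k. (i,j,k) \<in> J \<and> face_edges S T f i j k" if f: "f \<in> faces T" for f
  proof -
    have "\<forall>f\<in>faces T. \<exists>i j k. face_edges S T f i j k"
      using T by (simp add: is_triangulation_def)
    then obtain i j k where *: "face_edges S T f i j k" using f by blast
    then have "{(i,j,k), (j,k,i), (k,i,j), (j,i,k), (i,k,j), (k,j,i)} \<inter> J \<noteq> {}"
      using J[unfolded face_triples_def, THEN conjunct2, THEN conjunct1] f by simp
    then have "(i,j,k) \<in> J \<or> (j,i,k) \<in> J" using cyc by blast
    then show ?thesis using * face_edges_swap[OF *] by blast
  qed
  \<comment> \<open>Choosing one triple for each face, independently of \<open>A\<close>, turns the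
    area into a finite sum of smooth functions; \<open>face_area_eq\<close> identifies it with the
    area defined by \<open>SOME\<close>.\<close>
  then obtain x y z where xyz: "\<And>f. f \<in> faces T \<Longrightarrow> (x f, y f, z f) \<in> J"
    "\<And>f. f \<in> faces T \<Longrightarrow> face_edges S T f (x f) (y f) (z f)"
    by metis
  define \<tau> where "\<tau> f = (x f, y f, z f)" for f
  have face_area: "face_area S T J A f = heron (i,j,k) A"
    if "(i,j,k) \<in> J" "face_edges S T f i j k" for A f i j k
    unfolding heron_def case_prod_conv by (rule face_area_eq[OF T J that])
  have area: "area S T J = (\<lambda>A. \<Sum>f\<in>faces T. heron (\<tau> f) A)"
    unfolding area_def \<tau>_def using face_area xyz by (intro ext sum.cong) auto
  have pos: "0 < A $ (i,j,k)" "0 < A $ (j,k,i)" "0 < A $ (k,i,j)"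
    if "\<forall>p\<in>J. 0 < A $ p" "(i,j,k) \<in> J" for A :: "real^('b \<times> 'b \<times> 'b)" and i j k
    using that cyc by blast+
  define h' where "h' A v = (\<Sum>f\<in>faces T. heron_deriv (\<tau> f) A v)" for A v
  have "level_set J (range (A_coords J)) (area S T J) h'"
  proof
    show "J \<noteq> {}" using ne xyz by blast
    show "subspace (range (A_coords J))" by (rule subspace_range_A_coords)
    show "range (A_coords J) \<subseteq> coord_space J" by (auto simp: A_coords_def coord_space_def)
    show "0 < area S T J A" if "\<forall>p\<in>J. 0 < A $ p" for A
      unfolding area \<tau>_def using fin ne xyz by (intro sum_pos heron_pos pos[OF that]) auto
    show "area S T J (r *\<^sub>R A) = r\<^sup>2 * area S T J A" if "0 < r" for A r
      using that by (simp add: area heron_scale sum_distrib_left)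
    show "(area S T J has_derivative h' A) (at A)" if "\<forall>p\<in>J. 0 < A $ p" for A
      unfolding area h'_def[abs_def] \<tau>_def using xyz
      by (intro has_derivative_sum heron_has_derivative pos[OF that])
    show "continuous_on {A. \<forall>p\<in>J. 0 < A $ p} (\<lambda>A. h' A v)" for v
      unfolding h'_def \<tau>_def using xyz pos
      by (intro continuous_on_sum continuous_on_heron_deriv) blast+
    show "0 < h' A v" if A: "\<forall>p\<in>J. 0 < A $ p" and v: "\<forall>p\<in>J. 0 \<le> v $ p" "p \<in> J" "0 < v $ p" for A v p
    proof -
      obtain i j k where p: "p = (i,j,k)" by (cases p)
      with v face obtain f where f: "f \<in> faces T" "face_edges S T f i j k" by blast
      have "heron (\<tau> f) = heron (i,j,k)"
        using face_area v(2) f xyz unfolding p \<tau>_def by (metis ext)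
      moreover have "(heron (\<tau> f) has_derivative heron_deriv (\<tau> f) A) (at A)"
        unfolding \<tau>_def using xyz(1)[OF f(1)] by (intro heron_has_derivative pos[OF A])
      moreover have "(heron (i,j,k) has_derivative heron_deriv (i,j,k) A) (at A)"
        using v(2) p by (intro heron_has_derivative pos[OF A]) simp_all
      ultimately have "heron_deriv (\<tau> f) A = heron_deriv (i,j,k) A"
        using has_derivative_unique by metis
      moreover have "0 < heron_deriv (i,j,k) A v"
        using v p cyc[of i j k] by (intro heron_deriv_pos pos[OF A]) simp_all
      ultimately have "0 < heron_deriv (\<tau> f) A v" by simp
      moreover have "0 \<le> heron_deriv (\<tau> g) A v" if "g \<in> faces T" for g
        unfolding \<tau>_def using xyz(1)[OF that] v(1) cyc[OF xyz(1)[OF that]]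
        by (intro heron_deriv_nonneg pos[OF A]) simp_all
      ultimately show ?thesis
        unfolding h'_def using fin f(1) by (intro sum_pos2) auto
    qed
  qed
  then show ?thesis by blast
qed

theorem theorem5p2:
  fixes S :: "'s topology"
    and T :: "('s, 'e::finite) triangulation"
    and J :: "('e \<times> 'e \<times> 'e) set"
    and t :: real
  assumes "compact_surface S"
    and "is_triangulation S T"
    and "face_triples S T J"
    and "t \<in> {0..1}"
  shows "induced_by_finsler (euclidean_metrics1 S T J) (F_a J t) (eta_a J t) \<and>
         (\<forall>A\<in>euclidean_metrics1 S T J. \<forall>B\<in>euclidean_metrics1 S T J.
            \<exists>a b \<alpha>. a < b \<and> bigeodesic (euclidean_metrics1 S T J) (eta_a J t) a b \<alpha> \<and>
                    \<alpha> a = A \<and> \<alpha> b = B)"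
proof -
  obtain h' where "level_set J (range (A_coords J)) (area S T J) h'"
    using level_set_area assms by blast
  then interpret level_set J "range (A_coords J)" "area S T J" h' .
  have M: "euclidean_metrics1 S T J = M"
    unfolding euclidean_metrics1_def M_def euclidean_metrics_eq_cone[OF assms(2,3)] by blast
  show ?thesis
    unfolding M
    using induced_by_finsler_eta_a[OF assms(4)] geod_bigeodesic geod_ends zero_less_one by blast
qed

end
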